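(* Let $0<p<\infty$ and let $u$ be a weight on $\mathbb{R}_+^2$. The following conditions are equivalent: (a) $S: L^p_{\rm dec}(u)\to L^p(u)$ is bounded. (b) There exists a constant $C>0$ such that, for every decreasing set $D\subset\mathbb{R}_+^2$, $$\int_{\mathbb{R}_+^2\setminus D}\frac{|D_x^y|^p}{(xy)^p}\,u(x,y)\,dx\,dy\le C\int_D u(x,y)\,dx\,dy,$$ where $D_x^y=D\cap([0,x]\times[0,y])$. (c) Both $S_1: L^p_{\rm dec}(u)\to L^p(u)$ and $S_2: L^p_{\rm dec}(u)\to L^p(u)$ are bounded.
   Context: $\mathbb{R}_+=(0,\infty)$; $|\cdot|$ is Lebesgue measure; a weight is a nonnegative measurable function. For $f\ge0$ on $\mathbb{R}_+^2$, $$S_1f(x,y)=\frac1x\int_0^xf(s,y)\,ds,\qquad S_2f(x,y)=\frac1y\int_0^yf(x,t)\,dt,$$ $$Sf(x,y)=\frac1{xy}\int_0^x\int_0^yf(s,t)\,dt\,ds=S_1(S_2f)(x,y)=S_2(S_1f)(x,y).$$ $L^p(u)=L^p(\mathbb{R}_+^2,u(x,y)\,dx\,dy)$ with $\|f\|_{L^p(u)}=(\int|f|^pu)^{1/p}$, and $L^p_{\rm dec}(u)$ is the cone of nonnegative functions in $L^p(u)$ that are decreasing (non-increasing) in each variable separately. A set $D\subset\mathbb{R}_+^2$ is decreasing if $\chi_D$ is decreasing in each variable. An operator $T$ is bounded $L^p_{\rm dec}(u)\to L^p(u)$ if there is a constant $C'$ with $\|Tf\|_{L^p(u)}\le C'\|f\|_{L^p(u)}$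 for all $f\in L^p_{\rm dec}(u)$. *)

theory Defs
  imports "HOL-Analysis.Analysis"
begin

definition quadrant :: "(real \<times> real) set" where
  "quadrant = {0<..} \<times> {0<..}"

text \<open>Functions on the plane matter only through their values on \<^term>\<open>quadrant\<close>.
  Test functions take values in \<open>[0, \<infinity>]\<close>, so that averages of non-integrable
  functions make sense. Everything is measured with \<^term>\<open>lebesgue\<close> rather than
  \<^term>\<open>lborel\<close>: decreasing subsets of the quadrant are always Lebesgue measurable,
  but need not be Borel.\<close>

definition weight :: "(real \<times> real \<Rightarrow> real) \<Rightarrow> bool" where
  "weight u \<longleftrightarrow> u \<in> borel_measurable (lebesgue_on quadrant) \<and> (\<forall>z\<in>quadrant. 0 \<le> u z)"

text \<open>Real powers on \<open>[0, \<infinity>]\<close>, used only for exponents \<open>a > 0\<close>.\<close>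

definition ennpowr :: "ennreal \<Rightarrow> real \<Rightarrow> ennreal" where
  "ennpowr t a = (if t = \<infinity> then \<infinity> else ennreal (enn2real t powr a))"

definition S1 :: "(real \<times> real \<Rightarrow> ennreal) \<Rightarrow> real \<times> real \<Rightarrow> ennreal" where
  "S1 f = (\<lambda>(x, y). ennreal (1 / x) * (\<integral>\<^sup>+ s \<in> {0<..<x}. f (s, y) \<partial>lebesgue))"

definition S2 :: "(real \<times> real \<Rightarrow> ennreal) \<Rightarrow> real \<times> real \<Rightarrow> ennreal" where
  "S2 f = (\<lambda>(x, y). ennreal (1 / y) * (\<integral>\<^sup>+ t \<in> {0<..<y}. f (x, t) \<partial>lebesgue))"

definition S :: "(real \<times> real \<Rightarrow> ennreal) \<Rightarrow> real \<times> real \<Rightarrow> ennreal" where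
  "S f = (\<lambda>(x, y). ennreal (1 / (x * y)) *
     (\<integral>\<^sup>+ s \<in> {0<..<x}. (\<integral>\<^sup>+ t \<in> {0<..<y}. f (s, t) \<partial>lebesgue) \<partial>lebesgue))"

definition Lp_norm :: "real \<Rightarrow> (real \<times> real \<Rightarrow> real) \<Rightarrow> (real \<times> real \<Rightarrow> ennreal) \<Rightarrow> ennreal" where
  "Lp_norm p u f =
     ennpowr (\<integral>\<^sup>+ z \<in> quadrant. (ennpowr (f z) p * ennreal (u z)) \<partial>lebesgue) (1 / p)"

definition decreasing2 :: "(real \<times> real \<Rightarrow> ennreal) \<Rightarrow> bool" where
  "decreasing2 f \<longleftrightarrow>
     (\<forall>y>0. antimono_on {0<..} (\<lambda>x. f (x, y))) \<and>
     (\<forall>x>0. antimono_on {0<..} (\<lambda>y. f (x, y)))"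

definition Lp_dec :: "real \<Rightarrow> (real \<times> real \<Rightarrow> real) \<Rightarrow> (real \<times> real \<Rightarrow> ennreal) set" where
  "Lp_dec p u = {f. f \<in> borel_measurable (lebesgue_on quadrant) \<and> Lp_norm p u f < \<infinity> \<and> decreasing2 f}"

definition bounded_Lp_dec ::
  "real \<Rightarrow> (real \<times> real \<Rightarrow> real) \<Rightarrow>
   ((real \<times> real \<Rightarrow> ennreal) \<Rightarrow> real \<times> real \<Rightarrow> ennreal) \<Rightarrow> bool" where
  "bounded_Lp_dec p u T \<longleftrightarrow>
     (\<exists>C\<ge>0. \<forall>f\<in>Lp_dec p u. Lp_norm p u (T f) \<le> ennreal C * Lp_norm p u f)"

definition decreasing_set :: "(real \<times> real) set \<Rightarrow> bool" where
  "decreasing_set D \<longleftrightarrow> D \<subseteq> quadrant \<and> decreasing2 (indicator D)"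

definition corner :: "(real \<times> real) set \<Rightarrow> real \<Rightarrow> real \<Rightarrow> (real \<times> real) set" where
  "corner D x y = D \<inter> ({0..x} \<times> {0..y})"

end

theory Submission
  imports Defs
begin

text \<open>Condition (b) is the \<open>L\<^sup>p\<close> inequality for \<open>S\<close> on characteristic functions of decreasing sets. Since
  \<open>S\<^sub>1 \<chi>\<^sub>D\<close> and \<open>S\<^sub>2 \<chi>\<^sub>D\<close> are at most \<open>S \<chi>\<^sub>D\<close>, it yields the same for \<open>S\<^sub>1\<close> and
  \<open>S\<^sub>2\<close>. This extends to all decreasing functions because \<open>S\<^sub>i\<close> is one-dimensional. For \<open>p \<le> 1\<close>, decompose \<open>f\<close> into dyadic level sets and use subadditivity of
  \<open>t\<^sup>p\<close>. For \<open>p > 1\<close>, the function \<open>h = f (S\<^sub>i f)\<^bsup>p-1\<^esup>\<close> is again decreasing and \<open>(S\<^sub>i f)\<^sup>p\<close> is dominated by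
  \<open>\<Sum>\<^sub>j 2\<^sup>j (S\<^sub>i \<chi>\<^bsub>{h > 2\<^sup>j}\<^esub>)\<^sup>p\<close>, so that \<open>\<integral> (S\<^sub>i f)\<^sup>p u \<le> K \<integral> f (S\<^sub>i f)\<^bsup>p-1\<^esup> u\<close>; the right-hand side is
  absorbed by a Young-type inequality, after truncating \<open>f\<close> to make the left-hand side finite. Finally
  \<open>S = S\<^sub>1 S\<^sub>2\<close> is bounded as a composition, and conversely \<open>S f\<close> dominates \<open>S\<^sub>1 f\<close> and \<open>S\<^sub>2 f\<close>.\<close>

section \<open>Real powers on the extended half-line\<close>

lemma ennpowr_ennreal [simp]: "0 \<le> t \<Longrightarrow> ennpowr (ennreal t) a = ennreal (t powr a)"
  by (simp add: ennpowr_def)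

lemma ennpowr_top [simp]: "ennpowr top a = top"
  by (simp add: ennpowr_def)

lemma ennpowr_0 [simp]: "ennpowr 0 a = 0"
  by (simp add: ennpowr_def)

lemma ennpowr_1 [simp]: "ennpowr 1 a = 1"
  by (simp add: ennpowr_def)

lemma ennpowr_lt_top [simp]: "ennpowr t a < top \<longleftrightarrow> t < top"
  by (cases t) auto

lemma ennpowr_mono: "s \<le> t \<Longrightarrow> 0 \<le> a \<Longrightarrow> ennpowr s a \<le> ennpowr t a"
  by (cases s; cases t) (auto intro!: powr_mono2 simp: ennreal_le_iff top_unique)

lemma ennpowr_mult: "0 < a \<Longrightarrow> ennpowr (s * t) a = ennpowr s a * ennpowr t a"
proof (cases s; cases t)
  fix r r' assume "s = ennreal r" "0 \<le> r" "t = ennreal r'" "0 \<le> r'"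
  then show ?thesis
    by (simp add: ennreal_mult[symmetric] powr_mult)
qed (auto simp: ennreal_mult_top ennreal_top_mult)

lemma ennpowr_ennpowr: "ennpowr (ennpowr t a) b = ennpowr t (a * b)"
  by (cases t) (auto simp: powr_powr)

lemma ennpowr_one_right [simp]: "ennpowr t 1 = t"
  by (cases t) auto

lemma ennpowr_add: "ennpowr t (a + b) = ennpowr t a * ennpowr t b"
  by (cases t) (auto simp: powr_add ennreal_mult ennreal_top_mult)

text \<open>For \<open>0 < a\<close> the map \<open>t \<mapsto> ennpowr t a\<close> is an order
  isomorphism of the extended half-line with inverse exponent \<open>1 / a\<close>. It therefore
  commutes with suprema, and no continuity argument enters.\<close>

lemma ennpowr_SUP:
  assumes "0 < a"
  shows "ennpowr (SUP n. g n) a = (SUP n. ennpowr (g n) a)"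
proof (rule antisym)
  let ?v = "SUP n. ennpowr (g n) a"
  have "g n \<le> ennpowr ?v (1 / a)" for n
  proof -
    have "ennpowr (ennpowr (g n) a) (1 / a) \<le> ennpowr ?v (1 / a)"
      using assms by (intro ennpowr_mono SUP_upper) auto
    then show ?thesis
      using assms by (simp add: ennpowr_ennpowr)
  qed
  then have "(SUP n. g n) \<le> ennpowr ?v (1 / a)"
    by (rule SUP_least)
  then have "ennpowr (SUP n. g n) a \<le> ennpowr (ennpowr ?v (1 / a)) a"
    using assms by (intro ennpowr_mono) auto
  then show "ennpowr (SUP n. g n) a \<le> ?v"
    using assms by (simp add: ennpowr_ennpowr)
  show "?v \<le> ennpowr (SUP n. g n) a"
    using assms by (intro SUP_least ennpowr_mono SUP_upper) auto
qed

text \<open>The shares \<open>s / (s + t)\<close> and \<open>t / (s + t)\<close> lie in the unit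
  interval and sum to 1, and there \<open>r \<le> r powr a\<close> because
  \<open>a \<le> 1\<close>.\<close>

lemma powr_sum_le:
  fixes s t :: real
  assumes "0 < a" "a \<le> 1" "0 \<le> s" "0 \<le> t"
  shows "(s + t) powr a \<le> s powr a + t powr a"
proof (cases "s + t = 0")
  case False
  then have st: "0 < s + t" using assms by linarith
  have *: "r / (s + t) \<le> (r / (s + t)) powr a" if "0 \<le> r" "r \<le> s + t" for r
  proof (cases "r = 0")
    case False
    have "(r / (s + t)) powr 1 \<le> (r / (s + t)) powr a"
      using that st assms False by (intro powr_mono') auto
    then show ?thesis using that st by simp
  qed simp
  have "1 = s / (s + t) + t / (s + t)"
    using st by (simp add: add_divide_distrib[symmetric])
  also have "\<dots> \<le> (s / (s + t)) powr a + (t / (s + t)) powr a"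
    using * assms by (intro add_mono) auto
  also have "\<dots> = (s powr a + t powr a) / (s + t) powr a"
    using assms by (simp add: powr_divide add_divide_distrib)
  finally show ?thesis using st by (simp add: field_simps)
qed (use assms in auto)

lemma ennpowr_sum_le:
  assumes "0 < a" "a \<le> 1" "finite I"
  shows "ennpowr (\<Sum>i\<in>I. f i) a \<le> (\<Sum>i\<in>I. ennpowr (f i) a)"
  using assms(3)
proof induction
  case (insert i I)
  have "ennpowr (s + t) a \<le> ennpowr s a + ennpowr t a" for s t
  proof (cases s; cases t)
    fix r r' assume "s = ennreal r" "0 \<le> r" "t = ennreal r'" "0 \<le> r'"
    then show ?thesis
      using powr_sum_le[OF assms(1,2), of r r'] by (simp flip: ennreal_plus)
  qed auto
  from this[of "f i" "sum f I"] insert show ?case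
    by (simp add: order_trans add_left_mono)
qed simp

lemma borel_measurable_ennpowr [measurable]: "(\<lambda>t. ennpowr t a) \<in> borel_measurable borel"
  unfolding ennpowr_def by measurable

text \<open>A Young inequality with a free parameter and crude constants. Comparing \<open>w\<close>
  with \<open>R * v\<close> shows which of the two terms dominates, and infinite values cause no
  trouble. A large \<open>R\<close> makes the coefficient of \<open>w\<close> small, which is what
  the absorption argument for \<open>p > 1\<close> requires.\<close>

lemma mult_ennpowr_le:
  assumes "1 < p" "0 < R"
  shows "v * ennpowr w (p - 1) \<le> ennreal (R powr (p - 1)) * ennpowr v p + ennreal (1 / R) * ennpowr w p"
proof (cases "w \<le> ennreal R * v")
  case True
  have "v * ennpowr w (p - 1) \<le> v * ennpowr (ennreal R * v) (p - 1)"
    using True assms by (intro mult_left_mono ennpowr_mono) auto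
  also have "\<dots> = ennreal (R powr (p - 1)) * (v * ennpowr v (p - 1))"
    using assms by (simp add: ennpowr_mult ac_simps)
  also have "v * ennpowr v (p - 1) = ennpowr v p"
    using ennpowr_add[of v 1 "p - 1"] by simp
  finally show ?thesis by (simp add: add_increasing2)
next
  case False
  have "v = ennreal (1 / R) * (ennreal R * v)"
    using assms by (simp add: mult.assoc[symmetric] flip: ennreal_mult)
  also have "\<dots> \<le> ennreal (1 / R) * w"
    using False by (intro mult_left_mono) auto
  finally have "v * ennpowr w (p - 1) \<le> ennreal (1 / R) * w * ennpowr w (p - 1)"
    by (intro mult_right_mono) auto
  also have "\<dots> = ennreal (1 / R) * ennpowr w p"
    using ennpowr_add[of w 1 "p - 1"] by (simp add: ac_simps)
  finally show ?thesis by (simp add: add_increasing)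
qed

text \<open>The largest level strictly below \<open>t\<close> is at least \<open>t / 2\<close>. The
  hypotheses guarantee that such a level exists among the first \<open>m\<close> unless
  \<open>t = 0\<close>.\<close>

lemma dyadic_levels_ge:
  fixes t :: ennreal
  assumes "0 < a" "t = 0 \<or> ennreal a < t" "t \<le> ennreal (a * 2 ^ m)"
  shows "t \<le> 2 * (\<Sum>i<m. ennreal (a * 2 ^ i) * indicator {s. ennreal (a * 2 ^ i) < s} t)"
  using assms(3)
proof (induction m)
  case (Suc m)
  show ?case
  proof (cases "t \<le> ennreal (a * 2 ^ m)")
    case True
    show ?thesis
      using Suc.IH[OF True] by (simp add: distrib_left add_increasing2)
  next
    case False
    have "t \<le> 2 * ennreal (a * 2 ^ m)"
      using Suc.prems assms by (simp add: ennreal_mult ac_simps)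
    then show ?thesis
      using False by (simp add: distrib_left add_increasing)
  qed
qed (use assms in auto)

text \<open>The levels below \<open>t\<close> have \<open>q\<close>-th powers in geometric
  progression, so their sum is controlled by the largest one, which is at most \<open>t\<close> to
  the \<open>q\<close>. The constant is the sum of the geometric series of ratio
  \<open>2 powr - q\<close>.\<close>

lemma dyadic_levels_le:
  fixes t :: ennreal
  assumes "0 < a" "0 < q"
  shows "(\<Sum>i<m. ennpowr (ennreal (a * 2 ^ i)) q * indicator {s. ennreal (a * 2 ^ i) < s} t)
           \<le> ennreal (1 / (1 - 2 powr - q)) * ennpowr t q"
proof (induction m)
  case (Suc m)
  define c where "c = 1 / (1 - 2 powr - q)"
  have q1: "2 powr - q < 1"
    using assms powr_less_mono[of "- q" 0 2] by simp
  then have c: "0 < c" by (simp add: c_def)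
  \<comment> \<open>This fixed-point identity is what closes the induction on the number of levels
    below.\<close>
  have cc: "c * 2 powr - q + 1 = c"
  proof -
    have "1 - 2 powr - q \<noteq> 0" using q1 by linarith
    then show ?thesis by (simp only: c_def) (simp add: divide_simps)
  qed
  show ?case
  proof (cases "ennreal (a * 2 ^ m) < t")
    case True
    \<comment> \<open>The bound is \<open>c\<close> times the \<open>q\<close>-th power of the last
      level summed, namely \<open>a * 2 ^ (n - 1)\<close> in real exponents, written in a form that
      also covers the empty sum.\<close>
    have "(\<Sum>i<n. (a * 2 ^ i) powr q) \<le> c * (a * 2 ^ n) powr q * 2 powr - q" for n
    proof (induction n)
      case (Suc n)
      have "(\<Sum>i<Suc n. (a * 2 ^ i) powr q) \<le> (a * 2 ^ n) powr q * (c * 2 powr - q + 1)"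
        using Suc by (simp add: algebra_simps)
      also have "\<dots> = c * (a * 2 ^ n) powr q"
        by (simp add: cc)
      also have "\<dots> = c * (a * 2 ^ Suc n) powr q * 2 powr - q"
        using assms by (simp add: powr_mult powr_minus field_simps)
      finally show ?case .
    qed (use c in auto)
    from this[of "Suc m"] have "(\<Sum>i<Suc m. (a * 2 ^ i) powr q) \<le> c * (a * 2 ^ m) powr q"
      using assms by (simp add: powr_mult powr_minus field_simps)
    then have *: "(\<Sum>i<Suc m. ennreal ((a * 2 ^ i) powr q)) \<le> ennreal (c * (a * 2 ^ m) powr q)"
      by (subst sum_ennreal) (auto intro!: ennreal_leI)
    have "(\<Sum>i<Suc m. ennpowr (ennreal (a * 2 ^ i)) q * indicator {s. ennreal (a * 2 ^ i) < s} t)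
      \<le> (\<Sum>i<Suc m. ennreal ((a * 2 ^ i) powr q))"
      using assms by (intro sum_mono) (auto split: split_indicator)
    also note *
    also have "ennreal (c * (a * 2 ^ m) powr q) = ennreal c * ennpowr (ennreal (a * 2 ^ m)) q"
      using assms c by (subst ennpowr_ennreal) (auto simp: ennreal_mult)
    also have "\<dots> \<le> ennreal c * ennpowr t q"
      using True assms by (intro mult_left_mono ennpowr_mono) auto
    finally show ?thesis by (simp add: c_def)
  qed (use Suc in simp)
qed simp

section \<open>Decreasing sets and functions\<close>

lemma quadrant_iff: "z \<in> quadrant \<longleftrightarrow> 0 < fst z \<and> 0 < snd z"
  by (cases z) (auto simp: quadrant_def)

lemma quadrant_Pair [simp]: "(x, y) \<in> quadrant \<longleftrightarrow> 0 < x \<and> 0 < y"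
  by (simp add: quadrant_iff)

lemma quadrant_borel [measurable]: "quadrant \<in> sets borel"
  unfolding quadrant_def by (intro borel_open open_Times) auto

text \<open>Two comparable points are joined by changing one coordinate at a time. The product order
  treats both coordinates alike, which allows a single argument to serve \<open>S1\<close> and
  \<open>S2\<close>.\<close>

lemma decreasing2_iff: "decreasing2 f \<longleftrightarrow> antimono_on quadrant f"
proof
  assume f: "decreasing2 f"
  show "antimono_on quadrant f"
  proof (rule monotone_onI)
    fix z w assume zw: "z \<in> quadrant" "w \<in> quadrant" "z \<le> w"
    then have *: "antimono_on {0<..} (\<lambda>x. f (x, snd w))" "antimono_on {0<..} (\<lambda>y. f (fst z, y))"
      using f by (auto simp: decreasing2_def quadrant_iff)
    have "f (fst w, snd w) \<le> f (fst z, snd w)"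
      using monotone_onD[OF *(1), of "fst z" "fst w"] zw by (auto simp: quadrant_iff less_eq_prod_def)
    also have "\<dots> \<le> f (fst z, snd z)"
      using monotone_onD[OF *(2), of "snd z" "snd w"] zw by (auto simp: quadrant_iff less_eq_prod_def)
    finally show "f w \<le> f z" by simp
  qed
next
  assume "antimono_on quadrant f"
  from monotone_onD[OF this] show "decreasing2 f"
    by (auto simp: decreasing2_def less_eq_prod_def intro!: monotone_onI)
qed

lemma decreasing_set_iff:
  "decreasing_set D \<longleftrightarrow> D \<subseteq> quadrant \<and> (\<forall>z\<in>quadrant. \<forall>w\<in>D. z \<le> w \<longrightarrow> z \<in> D)"
proof -
  have "antimono_on quadrant (indicator D :: _ \<Rightarrow> ennreal) \<longleftrightarrow>
      (\<forall>z\<in>quadrant. \<forall>w\<in>D. z \<le> w \<longrightarrow> z \<in> D)" if "D \<subseteq> quadrant"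
  proof -
    have "indicator D w \<le> (indicator D z :: ennreal) \<longleftrightarrow> (w \<in> D \<longrightarrow> z \<in> D)" for w z
      by (auto split: split_indicator)
    then show ?thesis
      unfolding monotone_on_def using that by blast
  qed
  then show ?thesis
    by (auto simp: decreasing_set_def decreasing2_iff)
qed

lemma antimono_on_indicator: "decreasing_set D \<Longrightarrow> antimono_on quadrant (indicator D :: _ \<Rightarrow> ennreal)"
  by (simp add: decreasing_set_def decreasing2_iff)

lemma decreasing_set_superlevel:
  assumes "antimono_on quadrant f"
  shows "decreasing_set {z \<in> quadrant. (t :: ennreal) < f z}"
  using monotone_onD[OF assms] by (force simp: decreasing_set_iff intro: less_le_trans)

lemma decreasing_setD:
  assumes "decreasing_set D" "(x', y') \<in> D"
  shows "0 < x'" "0 < y'" "0 < x \<Longrightarrow> 0 < y \<Longrightarrow> x \<le> x' \<Longrightarrow> y \<le> y' \<Longrightarrow> (x, y) \<in> D"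
proof -
  show "0 < x'" "0 < y'"
    using assms by (auto simp: decreasing_set_iff)
  assume "0 < x" "0 < y" "x \<le> x'" "y \<le> y'"
  then have "(x, y) \<in> quadrant" "(x, y) \<le> (x', y')"
    by (auto simp: less_eq_prod_def)
  then show "(x, y) \<in> D"
    using assms unfolding decreasing_set_iff by blast
qed

text \<open>Such a set is order-convex, hence an interval.\<close>

lemma downward_closed_borel:
  fixes E :: "real set"
  assumes "\<And>s t. s \<in> E \<Longrightarrow> 0 < t \<Longrightarrow> t \<le> s \<Longrightarrow> t \<in> E" "E \<subseteq> {0<..}"
  shows "E \<in> sets borel"
  using assms by (intro real_interval_borel_measurable) (force simp: is_interval_1)

text \<open>By Tonelli, \<open>B - A\<close> is a null set; this is why decreasing sets are Lebesgue measurable.\<close>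

lemma decreasing_set_sandwich:
  assumes "decreasing_set D"
  obtains A B where "A \<in> sets borel" "B \<in> sets borel" "A \<subseteq> D" "D \<subseteq> B"
    "\<And>x y y'. (x, y) \<in> B - A \<Longrightarrow> (x, y') \<in> B - A \<Longrightarrow> y = y'"
proof -
  define Q where "Q = (\<rat> \<inter> {0<..} :: real set)"
  define E where "E q = {x. (x, q) \<in> D}" for q :: real
  \<comment> \<open>On each vertical line \<open>A\<close> and \<open>B\<close> are the section of
    \<open>D\<close> without and with its upper endpoint, detected through rational heights.
    Countability of \<open>Q\<close> and the fact that each \<open>E q\<close> is an interval make
    both sets Borel.\<close>
  define A where "A = (\<Union>q\<in>Q. E q \<times> {0<..<q})"
  define B where "B = quadrant \<inter> (\<Inter>q\<in>Q. E q \<times> UNIV \<union> UNIV \<times> {..q})"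
  note D = decreasing_setD(1,2)[OF assms] and down = decreasing_setD(3)[OF assms]
  have Q: "countable Q" "Q \<noteq> {}"
    using countable_rat by (auto simp: Q_def intro!: exI[of _ 1] countable_Int1)
  have E: "E q \<in> sets borel" for q
  proof (rule downward_closed_borel)
    show "t \<in> E q" if "s \<in> E q" "0 < t" "t \<le> s" for s t
      using down[of s q t q] D(2)[of s q] that by (auto simp: E_def)
    show "E q \<subseteq> {0<..}"
      using D(1) by (auto simp: E_def)
  qed
  show thesis
  proof
    show "A \<in> sets borel" "B \<in> sets borel"
      using Q E unfolding A_def B_def
      by (auto intro!: sets.countable_UN'' sets.countable_INT'' sets.Int sets.Un borel_Times)
    show "A \<subseteq> D"
    proof
      fix z assume "z \<in> A"
      then obtain q where "(fst z, q) \<in> D" "0 < snd z" "snd z < q"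
        by (auto simp: A_def E_def)
      then show "z \<in> D"
        using down[of "fst z" q "fst z" "snd z"] D(1)[of "fst z" q] by simp
    qed
    show "D \<subseteq> B"
    proof clarify
      fix x y assume z: "(x, y) \<in> D"
      then have "(x, q) \<in> D" if "q \<in> Q" "q < y" for q
        using down[OF z, of x q] D(1)[OF z] that by (auto simp: Q_def)
      then show "(x, y) \<in> B"
        using D[OF z] by (auto simp: B_def E_def not_le)
    qed
    \<comment> \<open>A rational height \<open>q\<close> between \<open>y\<close> and
      \<open>y'\<close> belongs to the section of \<open>D\<close> because
      \<open>(x, y') \<in> B\<close>, and then \<open>(x, y)\<close> lies below it and so in
      \<open>A\<close>.\<close>
    have less: False if "(x, y) \<in> B - A" "(x, y') \<in> B - A" "y < y'" for x y y'
    proof -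
      obtain q where q: "q \<in> \<rat>" "y < q" "q < y'"
        using Rats_dense_in_real[OF \<open>y < y'\<close>] by auto
      then have "q \<in> Q" "0 < y"
        using that by (auto simp: Q_def B_def)
      moreover from this have "x \<in> E q"
        using that q by (auto simp: B_def)
      ultimately have "(x, y) \<in> A"
        using q by (auto simp: A_def)
      then show False using that by simp
    qed
    show "y = y'" if "(x, y) \<in> B - A" "(x, y') \<in> B - A" for x y y'
      using less[of x y y'] less[of x y' y] that by (meson linorder_neqE_linordered_idom)
  qed
qed

lemma decreasing_set_lebesgue:
  assumes "decreasing_set D"
  shows "D \<in> sets lebesgue"
proof -
  obtain A B where AB: "A \<in> sets borel" "B \<in> sets borel" "A \<subseteq> D" "D \<subseteq> B"
    and sec: "\<And>x y y'. (x, y) \<in> B - A \<Longrightarrow> (x, y') \<in> B - A \<Longrightarrow> y = y'"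
    using decreasing_set_sandwich[OF assms] by metis
  have "emeasure lborel (B - A) = (\<integral>\<^sup>+x. emeasure lborel (Pair x -` (B - A)) \<partial>lborel)"
    using lborel.emeasure_pair_measure_alt[of "B - A" lborel] AB unfolding lborel_prod by simp
  also have "\<dots> = (\<integral>\<^sup>+x. 0 \<partial>(lborel :: real measure))"
  proof (intro nn_integral_cong)
    fix x
    have "Pair x -` (B - A) = {} \<or> (\<exists>y. Pair x -` (B - A) = {y})"
      using sec[of x] by blast
    then show "emeasure lborel (Pair x -` (B - A)) = 0" by auto
  qed
  finally have "B - A \<in> null_sets lborel"
    using AB by (auto simp: null_sets_def)
  then have "D - A \<in> null_sets (completion lborel)"
    using AB by (intro null_sets_completion_subset[of "D - A" "B - A"] null_sets_completionI) auto
  then have "A \<union> (D - A) \<in> sets lebesgue"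
    using AB by (intro sets.Un) auto
  then show ?thesis using AB by (simp add: Un_absorb1)
qed

text \<open>The superlevel sets are decreasing sets, hence Lebesgue measurable.\<close>

lemma antimono_on_quadrant_measurable:
  fixes f :: "real \<times> real \<Rightarrow> ennreal"
  assumes "antimono_on quadrant f"
  shows "f \<in> borel_measurable (lebesgue_on quadrant)"
proof (rule borel_measurableI_greater)
  fix t
  have "{z \<in> quadrant. t < f z} \<in> sets lebesgue"
    by (intro decreasing_set_lebesgue decreasing_set_superlevel assms)
  then show "{z \<in> space (lebesgue_on quadrant). t < f z} \<in> sets (lebesgue_on quadrant)"
    by (auto simp: sets_restrict_space_iff space_restrict_space)
qed

text \<open>A corner lies in a bounded box, so its area is finite and \<open>measure\<close> does
  not return its default value 0 for infinite measure.\<close>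

lemma corner_lebesgue:
  assumes "decreasing_set D"
  shows "corner D x y \<in> sets lebesgue" "ennreal (measure lebesgue (corner D x y)) = emeasure lebesgue (corner D x y)"
proof -
  have *: "{0..x} \<times> {0..y} = cbox (0, 0) (x, y)"
    by (auto simp: cbox_interval less_eq_prod_def)
  show D: "corner D x y \<in> sets lebesgue"
    unfolding corner_def using decreasing_set_lebesgue[OF assms] by (auto simp: *)
  have "emeasure lebesgue (corner D x y) \<le> emeasure lebesgue (cbox (0, 0) (x, y))"
    by (intro emeasure_mono) (auto simp: corner_def *)
  also have "\<dots> < \<infinity>"
    by (simp add: emeasure_lborel_cbox_eq)
  finally show "ennreal (measure lebesgue (corner D x y)) = emeasure lebesgue (corner D x y)"
    by (intro emeasure_eq_ennreal_measure[symmetric]) auto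
qed

lemma decreasing_set_section_borel:
  assumes "decreasing_set D"
  shows "{t. (s, t) \<in> D} \<in> sets borel" "{s. (s, t) \<in> D} \<in> sets borel"
proof -
  note D = decreasing_setD[OF assms]
  show "{t. (s, t) \<in> D} \<in> sets borel"
    by (rule downward_closed_borel) (use D(1,2) D(3)[of s _ s] in auto)
  show "{s. (s, t) \<in> D} \<in> sets borel"
    by (rule downward_closed_borel) (use D(1,2) D(3)[of _ t _ t] in auto)
qed

text \<open>Tonelli for a set that may fail to be Borel: it is applied to the Borel superset
  \<open>B\<close> of the sandwich, whose vertical sections exceed those of \<open>D\<close> by at
  most one point.\<close>

lemma emeasure_corner_le:
  assumes D: "decreasing_set D"
  shows "emeasure lebesgue (corner D x y)
    \<le> (\<integral>\<^sup>+ s \<in> {0<..<x}. (\<integral>\<^sup>+ t \<in> {0<..<y}. indicator D (s, t) \<partial>lebesgue) \<partial>lebesgue)"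
proof -
  obtain A B where AB: "A \<in> sets borel" "B \<in> sets borel" "A \<subseteq> D" "D \<subseteq> B"
    and sec: "\<And>x y y'. (x, y) \<in> B - A \<Longrightarrow> (x, y') \<in> B - A \<Longrightarrow> y = y'"
    using decreasing_set_sandwich[OF D] by metis
  define R where "R = B \<inter> ({0<..x} \<times> {0<..y})"
  have R: "R \<in> sets borel"
    unfolding R_def using AB by (auto intro!: sets.Int borel_Times)
  have "corner D x y \<subseteq> R"
    using D AB by (auto simp: R_def corner_def decreasing_set_iff)
  then have "emeasure lebesgue (corner D x y) \<le> emeasure lborel R"
    using emeasure_mono[of "corner D x y" R lebesgue] R by simp
  also have "\<dots> = (\<integral>\<^sup>+s. emeasure lborel (Pair s -` R) \<partial>lborel)"
    using lborel.emeasure_pair_measure_alt[of R lborel] R unfolding lborel_prod by simp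
  also have "\<dots> \<le> (\<integral>\<^sup>+ s \<in> {0<..<x}. (\<integral>\<^sup>+ t \<in> {0<..<y}. indicator D (s, t) \<partial>lebesgue) \<partial>lborel)"
  proof (rule nn_integral_mono_AE)
    \<comment> \<open>\<open>R\<close> contains the edge \<open>s = x\<close>, which the open
      interval of integration omits. That single abscissa is discarded as a null set.\<close>
    show "AE s in lborel. emeasure lborel (Pair s -` R)
        \<le> (\<integral>\<^sup>+ t \<in> {0<..<y}. indicator D (s, t) \<partial>lebesgue) * indicator {0<..<x} s"
      using AE_lborel_singleton[of x]
    proof eventually_elim
      fix s assume s: "s \<noteq> x"
      define G where "G = {t. (s, t) \<in> D} \<inter> {0<..<y}"
      \<comment> \<open>\<open>N\<close> collects what the section of \<open>R\<close> may have
        beyond \<open>G\<close>: the endpoint \<open>y\<close> and at most one point of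
        \<open>B - A\<close>.\<close>
      define N where "N = insert y {t. (s, t) \<in> B - A}"
      have G: "G \<in> sets borel"
        using decreasing_set_section_borel[OF D] by (auto simp: G_def)
      have "{t. (s, t) \<in> B - A} = {} \<or> (\<exists>t. {t. (s, t) \<in> B - A} = {t})"
        using sec[of s] by blast
      then have "finite {t. (s, t) \<in> B - A}"
        by (metis finite.emptyI finite.insertI)
      then have "finite N" by (simp add: N_def)
      then have N: "N \<in> null_sets lborel"
        by (rule finite_imp_null_set_lborel)
      have *: "(\<integral>\<^sup>+ t \<in> {0<..<y}. indicator D (s, t) \<partial>lebesgue) = emeasure lborel G"
      proof -
        have "(\<integral>\<^sup>+ t \<in> {0<..<y}. indicator D (s, t) \<partial>lebesgue) = (\<integral>\<^sup>+ t. indicator G t \<partial>lborel)"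
          unfolding nn_integral_completion
          by (intro nn_integral_cong) (auto simp: G_def split: split_indicator)
        then show ?thesis using G by simp
      qed
      show "emeasure lborel (Pair s -` R)
        \<le> (\<integral>\<^sup>+ t \<in> {0<..<y}. indicator D (s, t) \<partial>lebesgue) * indicator {0<..<x} s"
      proof (cases "s \<in> {0<..<x}")
        case True
        have "Pair s -` R \<subseteq> G \<union> N"
          using AB by (auto simp: R_def G_def N_def)
        then have "emeasure lborel (Pair s -` R) \<le> emeasure lborel (G \<union> N)"
          using G N by (intro emeasure_mono) auto
        also have "\<dots> = emeasure lborel G"
          using G N by (intro emeasure_Un_null_set) auto
        finally show ?thesis using True by (simp add: *)
      next
        case False
        then have "Pair s -` R = {}" using s by (auto simp: R_def)
        then show ?thesis by simp
      qed
    qed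
  qed
  finally show ?thesis by (simp add: nn_integral_completion)
qed

lemma emeasure_Times_lebesgue:
  fixes E F :: "real set"
  assumes "E \<in> sets borel" "F \<in> sets borel"
  shows "emeasure lebesgue (E \<times> F) = emeasure lborel E * emeasure lborel F"
proof -
  have "emeasure lebesgue (E \<times> F) = emeasure lborel (E \<times> F)"
    using borel_Times[OF assms] by simp
  also have "\<dots> = emeasure lborel E * emeasure lborel F"
    using lborel.emeasure_pair_measure_Times[of E lborel F] assms unfolding lborel_prod by simp
  finally show ?thesis .
qed

section \<open>Averages of decreasing functions on the half-line\<close>

text \<open>The indicator discards the values of \<open>g\<close> outside the positive half-line,
  about which nothing is assumed. The superlevel sets of the product are then initial pieces of the
  half-line, or everything.\<close>

lemma antimono_on_pos_borel:
  fixes g :: "real \<Rightarrow> ennreal"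
  assumes "antimono_on {0<..} g"
  shows "(\<lambda>s. g s * indicator {0<..<x} s) \<in> borel_measurable borel"
proof (rule borel_measurableI_greater)
  fix t
  have "{s. t < g s * indicator {0<..<x} s} \<in> sets borel"
  proof (rule downward_closed_borel)
    show "{s. t < g s * indicator {0<..<x} s} \<subseteq> {0<..}"
      by (auto split: split_indicator_asm)
    fix s s' assume s: "s \<in> {s. t < g s * indicator {0<..<x} s}" "0 < s'" "s' \<le> s"
    then have "0 < s" "s < x"
      by (auto split: split_indicator_asm)
    then show "s' \<in> {s. t < g s * indicator {0<..<x} s}"
      using s monotone_onD[OF assms, of s' s] by (auto intro: less_le_trans)
  qed
  then show "{s \<in> space borel. t < g s * indicator {0<..<x} s} \<in> sets borel"
    by simp
qed

lemma antimono_on_le_average: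
  fixes g :: "real \<Rightarrow> ennreal"
  assumes g: "antimono_on {0<..} g" and x: "0 < x"
  shows "g x \<le> ennreal (1 / x) * (\<integral>\<^sup>+ s \<in> {0<..<x}. g s \<partial>lebesgue)"
proof -
  have "ennreal x * g x = (\<integral>\<^sup>+ s \<in> {0<..<x}. g x \<partial>lebesgue)"
    using x by (simp add: nn_integral_cmult_indicator mult.commute)
  also have "\<dots> \<le> (\<integral>\<^sup>+ s \<in> {0<..<x}. g s \<partial>lebesgue)"
    using x by (intro nn_integral_mono) (auto split: split_indicator intro: monotone_onD[OF g])
  finally have "ennreal (1 / x) * (ennreal x * g x) \<le> ennreal (1 / x) * (\<integral>\<^sup>+ s \<in> {0<..<x}. g s \<partial>lebesgue)"
    by (rule mult_left_mono) simp
  then show ?thesis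
    using x by (simp add: mult.assoc[symmetric] flip: ennreal_mult)
qed

text \<open>On the added piece from \<open>x\<close> to \<open>x'\<close> the function is at most
  \<open>g x\<close>, which is at most the average over the shorter interval. Extending the interval
  thus cannot raise the average. The estimate uses no subtraction of extended reals.\<close>

lemma average_antimono:
  fixes g :: "real \<Rightarrow> ennreal"
  assumes g: "antimono_on {0<..} g" and x: "0 < x" "x \<le> x'"
  shows "ennreal (1 / x') * (\<integral>\<^sup>+ s \<in> {0<..<x'}. g s \<partial>lebesgue)
       \<le> ennreal (1 / x) * (\<integral>\<^sup>+ s \<in> {0<..<x}. g s \<partial>lebesgue)"
proof -
  define A where "A = (\<integral>\<^sup>+ s \<in> {0<..<x}. g s \<partial>lebesgue)"
  have [measurable]: "(\<lambda>s. g s * indicator {0<..<x} s) \<in> borel_measurable borel"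
    by (rule antimono_on_pos_borel[OF g])
  have "(\<integral>\<^sup>+ s \<in> {0<..<x'}. g s \<partial>lebesgue)
      \<le> (\<integral>\<^sup>+ s. g s * indicator {0<..<x} s + g x * indicator {x..<x'} s \<partial>lebesgue)"
    using x by (intro nn_integral_mono) (auto split: split_indicator intro: monotone_onD[OF g])
  also have "\<dots> = A + g x * ennreal (x' - x)"
    using x by (subst nn_integral_add) (auto simp: A_def nn_integral_cmult_indicator measurable_completion)
  also have "\<dots> \<le> A + ennreal (1 / x) * A * ennreal (x' - x)"
    using antimono_on_le_average[OF g x(1)] unfolding A_def by (intro add_left_mono mult_right_mono) auto
  also have "\<dots> = A * (1 + ennreal (1 / x * (x' - x)))"
    using x by (subst ennreal_mult) (auto simp: distrib_left ac_simps)
  also have "1 + ennreal (1 / x * (x' - x)) = ennreal (x' / x)"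
    using x by (simp add: field_simps flip: ennreal_1 ennreal_plus)
  finally have "ennreal (1 / x') * (\<integral>\<^sup>+ s \<in> {0<..<x'}. g s \<partial>lebesgue) \<le> ennreal (1 / x') * (A * ennreal (x' / x))"
    by (rule mult_left_mono) simp
  also have "\<dots> = ennreal (1 / x' * (x' / x)) * A"
    using x by (subst ennreal_mult) (auto simp: ac_simps)
  also have "1 / x' * (x' / x) = 1 / x"
    using x by simp
  finally show ?thesis by (simp add: A_def)
qed

text \<open>A substitute for integrating the derivative \<open>p * g * F powr (p - 1)\<close> of
  \<open>F powr p\<close>, with the cruder constant \<open>2 powr p\<close>. The bound on
  \<open>g\<close> makes \<open>F\<close> finite and Lipschitz, so the intermediate value theorem
  provides a point where \<open>F\<close> has half its final value.\<close>

lemma integral_powr_le: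
  fixes g :: "real \<Rightarrow> ennreal"
  assumes p: "1 < p" and [measurable]: "g \<in> borel_measurable borel"
    and b: "\<And>s. g s \<le> ennreal b" and x: "0 < x"
  defines "F \<equiv> \<lambda>y. \<integral>\<^sup>+ s \<in> {0<..<y}. g s \<partial>lborel"
  shows "ennpowr (F x) p \<le> ennreal (2 powr p) * (\<integral>\<^sup>+ s \<in> {0<..<x}. (g s * ennpowr (F s) (p - 1)) \<partial>lborel)"
proof -
  \<comment> \<open>A Lipschitz constant must be nonnegative, while \<open>b\<close> may have any
    sign; \<open>ennreal\<close> sends negative numbers to 0, so the bound on \<open>g\<close>
    survives.\<close>
  define b' where "b' = max b 0"
  have b': "g s \<le> ennreal b'" "0 \<le> b'" for s
    by (auto simp: b'_def intro: order_trans[OF b ennreal_leI])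
  have split: "F y' = F y + (\<integral>\<^sup>+ s \<in> {y..<y'}. g s \<partial>lborel)" if "0 < y" "y \<le> y'" for y y'
    unfolding F_def using that
    by (subst nn_integral_add[symmetric]) (auto intro!: nn_integral_cong split: split_indicator)
  have F0: "F y = 0" if "y \<le> 0" for y
    using that by (simp add: F_def)
  have piece: "(\<integral>\<^sup>+ s \<in> {y..<y'}. g s \<partial>lborel) \<le> ennreal (b' * (y' - y))" if "y \<le> y'" for y y'
  proof -
    have "(\<integral>\<^sup>+ s \<in> {y..<y'}. g s \<partial>lborel) \<le> (\<integral>\<^sup>+ s \<in> {y..<y'}. ennreal b' \<partial>lborel)"
      using b' by (intro nn_integral_mono mult_right_mono) auto
    then show ?thesis
      using that b' by (simp add: nn_integral_cmult_indicator ennreal_mult)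
  qed
  have step: "F y' \<le> F y + ennreal (b' * (y' - y))" "F y \<le> F y'" if "0 \<le> y" "y \<le> y'" for y y'
  proof -
    have "F y' \<le> F y + ennreal (b' * (y' - y)) \<and> F y \<le> F y'"
    proof (cases "y = 0")
      case True
      have "F y' \<le> (\<integral>\<^sup>+ s \<in> {0..<y'}. g s \<partial>lborel)"
        unfolding F_def by (intro nn_integral_mono) (auto split: split_indicator)
      also have "\<dots> \<le> ennreal (b' * (y' - y))"
        using piece[of 0 y'] that True by simp
      finally show ?thesis using F0[of y] True by simp
    next
      case False
      with that split[of y y'] piece[of y y'] show ?thesis
        by (auto intro: add_left_mono)
    qed
    then show "F y' \<le> F y + ennreal (b' * (y' - y))" "F y \<le> F y'" by auto
  qed
  define \<Phi> where "\<Phi> y = enn2real (F y)" for y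
  have fin: "F y < top" if "0 \<le> y" for y
    using step(1)[of 0 y] that F0[of 0] by (auto simp: less_top[symmetric] top_unique)
  have F: "F y = ennreal (\<Phi> y)" if "0 \<le> y" for y
    using fin[OF that] by (simp add: \<Phi>_def)
  have \<Phi>_nn: "0 \<le> \<Phi> y" for y
    by (simp add: \<Phi>_def)
  have \<Phi>: "\<Phi> y' \<le> \<Phi> y + b' * (y' - y)" "\<Phi> y \<le> \<Phi> y'" if "0 \<le> y" "y \<le> y'" for y y'
    using step[OF that] that b' \<Phi>_nn
    by (simp_all add: F flip: ennreal_plus)
  \<comment> \<open>Beyond the point \<open>s0\<close> where \<open>F\<close> reaches half of \<open>F x\<close>, the factor \<open>F\<^bsup>p-1\<^esup>\<close> is comparable to
    \<open>(F x)\<^bsup>p-1\<^esup>\<close>, while \<open>g\<close> still has half of its integral there.\<close>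
  have "b'-lipschitz_on {0..x} \<Phi>"
  proof (rule lipschitz_onI)
    fix y y' assume "y \<in> {0..x}" "y' \<in> {0..x}"
    then show "dist (\<Phi> y) (\<Phi> y') \<le> b' * dist y y'"
      using \<Phi>[of y y'] \<Phi>[of y' y] by (cases "y \<le> y'") (auto simp: dist_real_def)
  qed (use b' in auto)
  then have "continuous_on {0..x} \<Phi>"
    by (rule lipschitz_on_continuous_on)
  then obtain s0 where s0: "0 \<le> s0" "s0 \<le> x" "\<Phi> s0 = \<Phi> x / 2"
    using IVT'[of \<Phi> 0 "\<Phi> x / 2" x] \<Phi>_nn[of x] x F0[of 0] by (auto simp: \<Phi>_def)
  show ?thesis
  proof (cases "\<Phi> x = 0")
    case True
    then show ?thesis using x by (simp add: F)
  next
    case False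
    then have "s0 > 0" using s0 F0[of 0] by (cases "s0 = 0") (auto simp: \<Phi>_def)
    have "ennreal (\<Phi> x) = ennreal (\<Phi> x / 2) + (\<integral>\<^sup>+ s \<in> {s0..<x}. g s \<partial>lborel)"
      using split[OF \<open>0 < s0\<close> s0(2)] s0 x by (simp add: F)
    moreover have "ennreal (\<Phi> x) = ennreal (\<Phi> x / 2) + ennreal (\<Phi> x / 2)"
      using \<Phi>_nn by (simp flip: ennreal_plus)
    ultimately have half: "(\<integral>\<^sup>+ s \<in> {s0..<x}. g s \<partial>lborel) = ennreal (\<Phi> x / 2)"
      using ennreal_add_left_cancel[of "ennreal (\<Phi> x / 2)"] by simp
    have "ennpowr (F x) p = ennreal (2 powr p) * (ennreal (\<Phi> x / 2) * ennpowr (ennreal (\<Phi> x / 2)) (p - 1))"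
    proof -
      have "ennreal (\<Phi> x / 2) * ennpowr (ennreal (\<Phi> x / 2)) (p - 1) = ennreal ((\<Phi> x / 2) powr p)"
        using ennpowr_add[of "ennreal (\<Phi> x / 2)" 1 "p - 1"] \<Phi>_nn[of x] by simp
      then show ?thesis
        using x \<Phi>_nn[of x] by (simp add: F powr_divide flip: ennreal_mult)
    qed
    also have "ennreal (\<Phi> x / 2) * ennpowr (ennreal (\<Phi> x / 2)) (p - 1)
        = (\<integral>\<^sup>+ s. ennpowr (ennreal (\<Phi> x / 2)) (p - 1) * (g s * indicator {s0..<x} s) \<partial>lborel)"
      by (subst nn_integral_cmult) (auto simp: half ac_simps)
    also have "\<dots> \<le> (\<integral>\<^sup>+ s \<in> {0<..<x}. (g s * ennpowr (F s) (p - 1)) \<partial>lborel)"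
    proof (rule nn_integral_mono)
      fix s
      have "ennpowr (ennreal (\<Phi> x / 2)) (p - 1) \<le> ennpowr (F s) (p - 1)" if "s0 \<le> s"
        using step(2)[OF s0(1) that] s0 p by (intro ennpowr_mono) (auto simp: F)
      then show "ennpowr (ennreal (\<Phi> x / 2)) (p - 1) * (g s * indicator {s0..<x} s)
          \<le> g s * ennpowr (F s) (p - 1) * indicator {0<..<x} s"
        using \<open>0 < s0\<close> by (auto split: split_indicator simp: mult.commute intro: mult_left_mono)
    qed
    finally show ?thesis by (simp add: mult_left_mono)
  qed
qed

section \<open>Averages along one coordinate\<close>

text \<open>Both \<^const>\<open>S1\<close> and \<^const>\<open>S2\<close> average over the segment \<open>{sec z s | 0 < s < coord z}\<close>, which joins
  a coordinate axis to \<open>z\<close>.\<close>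

locale section_average =
  fixes T :: "(real \<times> real \<Rightarrow> ennreal) \<Rightarrow> real \<times> real \<Rightarrow> ennreal"
    and coord :: "real \<times> real \<Rightarrow> real"
    and sec :: "real \<times> real \<Rightarrow> real \<Rightarrow> real \<times> real"
  assumes T_eq: "T f z = ennreal (1 / coord z) * (\<integral>\<^sup>+ s \<in> {0<..<coord z}. f (sec z s) \<partial>lebesgue)"
    and coord_pos: "z \<in> quadrant \<Longrightarrow> 0 < coord z"
    and sec_quadrant: "z \<in> quadrant \<Longrightarrow> 0 < s \<Longrightarrow> sec z s \<in> quadrant"
    and sec_coord: "sec z (coord z) = z"
    and coord_sec: "coord (sec z s) = s"
    and sec_sec: "sec (sec z s) t = sec z t"
    and coord_mono: "z \<le> w \<Longrightarrow> coord z \<le> coord w"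
    and sec_mono: "z \<le> w \<Longrightarrow> s \<le> t \<Longrightarrow> sec z s \<le> sec w t"
begin

lemma T_mono:
  assumes "\<And>w. w \<in> quadrant \<Longrightarrow> f w \<le> g w" "z \<in> quadrant"
  shows "T f z \<le> T g z"
  unfolding T_eq using assms(2)
  by (intro mult_left_mono nn_integral_mono) (auto split: split_indicator intro: assms(1) sec_quadrant)

lemma antimono_on_section:
  assumes "antimono_on quadrant f" "z \<in> quadrant"
  shows "antimono_on {0<..} (\<lambda>s. f (sec z s))"
  using assms by (intro monotone_onI monotone_onD[OF assms(1)]) (auto intro: sec_quadrant sec_mono)

lemma section_borel:
  fixes f :: "real \<times> real \<Rightarrow> ennreal"
  assumes "antimono_on quadrant f" "z \<in> quadrant"
  shows "(\<lambda>s. f (sec z s) * indicator {0<..<x} s) \<in> borel_measurable borel"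
  by (rule antimono_on_pos_borel[OF antimono_on_section[OF assms]])

lemma le_T:
  assumes "antimono_on quadrant f" "z \<in> quadrant"
  shows "f z \<le> T f z"
  using antimono_on_le_average[OF antimono_on_section[OF assms] coord_pos[OF assms(2)]]
  by (simp add: T_eq sec_coord)

text \<open>The passage from \<open>w\<close> to \<open>z\<close> has two moves: first the interval
  on the section through \<open>w\<close> is shortened to \<open>coord z\<close>, then the section
  itself is shifted to the one through \<open>z\<close>. Each move can only raise the
  average.\<close>

lemma T_antimono:
  assumes f: "antimono_on quadrant f"
  shows "antimono_on quadrant (T f)"
proof (rule monotone_onI)
  fix z w assume zw: "z \<in> quadrant" "w \<in> quadrant" "z \<le> w"
  have "T f w \<le> ennreal (1 / coord z) * (\<integral>\<^sup>+ s \<in> {0<..<coord z}. f (sec w s) \<partial>lebesgue)"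
    unfolding T_eq using zw
    by (intro average_antimono antimono_on_section f coord_pos coord_mono) auto
  also have "\<dots> \<le> T f z"
    unfolding T_eq using zw
    by (intro mult_left_mono nn_integral_mono)
      (auto split: split_indicator intro!: monotone_onD[OF f] sec_quadrant sec_mono)
  finally show "T f w \<le> T f z" .
qed

lemma T_const_le:
  assumes "\<And>w. w \<in> quadrant \<Longrightarrow> f w \<le> c" "z \<in> quadrant"
  shows "T f z \<le> c"
proof -
  have "T f z \<le> T (\<lambda>_. c) z"
    using assms by (rule T_mono)
  also have "\<dots> = ennreal (1 / coord z) * (c * ennreal (coord z))"
    using coord_pos[OF assms(2)] by (simp add: T_eq nn_integral_cmult_indicator)
  also have "\<dots> = ennreal (1 / coord z * coord z) * c"
    using coord_pos[OF assms(2)] by (subst ennreal_mult) (auto simp: ac_simps)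
  finally show ?thesis
    using coord_pos[OF assms(2)] by simp
qed

lemma T_cmult:
  assumes "antimono_on quadrant f" "z \<in> quadrant"
  shows "T (\<lambda>w. c * f w) z = c * T f z"
proof -
  have "(\<integral>\<^sup>+ s \<in> {0<..<coord z}. (c * f (sec z s)) \<partial>lebesgue)
      = c * (\<integral>\<^sup>+ s \<in> {0<..<coord z}. f (sec z s) \<partial>lebesgue)"
    using section_borel[OF assms, of "coord z"] unfolding nn_integral_completion
    by (subst nn_integral_cmult[symmetric]) (auto simp: ac_simps)
  then show ?thesis by (simp add: T_eq ac_simps)
qed

lemma T_sum:
  assumes "\<And>i. i \<in> I \<Longrightarrow> antimono_on quadrant (f i)" "z \<in> quadrant"
  shows "T (\<lambda>w. \<Sum>i\<in>I. f i w) z = (\<Sum>i\<in>I. T (f i) z)"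
proof -
  have "(\<integral>\<^sup>+ s \<in> {0<..<coord z}. (\<Sum>i\<in>I. f i (sec z s)) \<partial>lebesgue)
      = (\<Sum>i\<in>I. \<integral>\<^sup>+ s \<in> {0<..<coord z}. f i (sec z s) \<partial>lebesgue)"
    using section_borel[OF assms(1,2), of _ "coord z"] unfolding nn_integral_completion
    by (subst nn_integral_sum[symmetric]) (auto simp: sum_distrib_right)
  then show ?thesis by (simp add: T_eq sum_distrib_left)
qed

lemma T_SUP:
  assumes "\<And>n :: nat. antimono_on quadrant (f n)" "\<And>w. w \<in> quadrant \<Longrightarrow> incseq (\<lambda>n. f n w)" "z \<in> quadrant"
  shows "T (\<lambda>w. SUP n. f n w) z = (SUP n. T (f n) z)"
proof -
  have "(\<integral>\<^sup>+ s. (SUP n. f n (sec z s)) * indicator {0<..<coord z} s \<partial>lborel)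
      = (\<integral>\<^sup>+ s. (SUP n. f n (sec z s) * indicator {0<..<coord z} s) \<partial>lborel)"
    by (intro nn_integral_cong) (auto split: split_indicator)
  also have "\<dots> = (SUP n. \<integral>\<^sup>+ s. f n (sec z s) * indicator {0<..<coord z} s \<partial>lborel)"
  proof (rule nn_integral_monotone_convergence_SUP)
    show "incseq (\<lambda>n s. f n (sec z s) * indicator {0<..<coord z} s)"
      using assms(2)[OF sec_quadrant[OF assms(3)]]
      by (auto simp: incseq_def le_fun_def split: split_indicator)
    show "(\<lambda>s. f n (sec z s) * indicator {0<..<coord z} s) \<in> borel_measurable lborel" for n
      using section_borel[OF assms(1,3)] by simp
  qed
  finally show ?thesis
    by (simp add: T_eq nn_integral_completion SUP_mult_left_ennreal)
qed

text \<open>The pointwise core of the case \<open>p > 1\<close>. Along the segment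
  \<open>F s = s * T f\<close>, so the integrand \<open>g * F powr (p - 1)\<close> is
  \<open>h\<close> times \<open>s powr (p - 1)\<close>. Replacing \<open>h\<close> by its dyadic
  levels bounds the \<open>p\<close>-th power of \<open>T f\<close> by a sum of \<open>p\<close>-th
  powers of averages of indicators, with coefficients linear in the levels.\<close>

lemma T_powr_le_levels:
  assumes p: "1 < p" and f: "antimono_on quadrant f" "\<And>w. w \<in> quadrant \<Longrightarrow> f w \<le> ennreal b"
    and h: "\<And>w. h w = f w * ennpowr (T f w) (p - 1)"
    and lev: "0 < \<alpha>" "\<And>w. w \<in> quadrant \<Longrightarrow> h w = 0 \<or> ennreal \<alpha> < h w"
      "\<And>w. w \<in> quadrant \<Longrightarrow> h w \<le> ennreal (\<alpha> * 2 ^ m)"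
    and h_anti: "antimono_on quadrant h"
    and z: "z \<in> quadrant"
  shows "ennpowr (T f z) p \<le> ennreal (2 * 2 powr p) *
    (\<Sum>i<m. ennreal (\<alpha> * 2 ^ i) * ennpowr (T (indicator {w \<in> quadrant. ennreal (\<alpha> * 2 ^ i) < h w}) z) p)"
proof -
  define x where "x = coord z"
  have x: "0 < x" using coord_pos[OF z] by (simp add: x_def)
  define g where "g s = f (sec z s) * indicator {0<..<x} s" for s
  define F where "F y = (\<integral>\<^sup>+ s \<in> {0<..<y}. g s \<partial>lborel)" for y
  define L where "L i = ennreal (\<alpha> * 2 ^ i)" for i :: nat
  define E where "E i = {w \<in> quadrant. L i < h w}" for i
  \<comment> \<open>The length of the part of the segment inside \<open>E i\<close>; divided by
    \<open>x\<close> it is the average \<open>T (indicator (E i)) z\<close>.\<close>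
  define M where "M i = (\<integral>\<^sup>+ s \<in> {0<..<x}. indicator (E i) (sec z s) \<partial>lborel)" for i
  have E: "decreasing_set (E i)" for i
    unfolding E_def by (rule decreasing_set_superlevel[OF h_anti])
  have E_meas: "(\<lambda>s. indicator (E i) (sec z s) * indicator {0<..<x} s :: ennreal) \<in> borel_measurable borel" for i
    using E[of i] z by (intro section_borel) (auto simp: decreasing_set_def decreasing2_iff)
  have F: "F s = ennreal s * T f (sec z s)" if "0 < s" "s \<le> x" for s
  proof -
    have "F s = (\<integral>\<^sup>+ t \<in> {0<..<s}. f (sec z t) \<partial>lborel)"
      unfolding F_def g_def using that by (intro nn_integral_cong) (auto split: split_indicator)
    also have "\<dots> = ennreal (s * (1 / s)) * (\<integral>\<^sup>+ t \<in> {0<..<s}. f (sec z t) \<partial>lborel)"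
      using that by simp
    also have "\<dots> = ennreal s * T f (sec z s)"
      using that by (subst ennreal_mult) (auto simp: T_eq coord_sec sec_sec nn_integral_completion ac_simps)
    finally show ?thesis .
  qed
  have "ennpowr (F x) p \<le> ennreal (2 powr p) * (\<integral>\<^sup>+ s \<in> {0<..<x}. (g s * ennpowr (F s) (p - 1)) \<partial>lborel)"
    unfolding F_def
  proof (rule integral_powr_le[OF p _ _ x])
    show "g \<in> borel_measurable borel"
      using section_borel[OF f(1) z] by (simp add: g_def[abs_def])
    show "g s \<le> ennreal b" for s
      using f(2) z by (auto simp: g_def sec_quadrant split: split_indicator)
  qed
  also have "(\<integral>\<^sup>+ s \<in> {0<..<x}. (g s * ennpowr (F s) (p - 1)) \<partial>lborel)
      \<le> (\<integral>\<^sup>+ s. 2 * (\<Sum>i<m. (L i * ennpowr (M i) (p - 1)) * (indicator (E i) (sec z s) * indicator {0<..<x} s)) \<partial>lborel)"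
  proof (rule nn_integral_mono)
    fix s
    show "g s * ennpowr (F s) (p - 1) * indicator {0<..<x} s
       \<le> 2 * (\<Sum>i<m. (L i * ennpowr (M i) (p - 1)) * (indicator (E i) (sec z s) * indicator {0<..<x} s))"
    proof (cases "s \<in> {0<..<x}")
      case True
      then have s: "0 < s" "s < x" and w: "sec z s \<in> quadrant"
        using z by (auto intro: sec_quadrant)
      \<comment> \<open>\<open>E i\<close> meets the segment in an initial piece, so \<open>s\<^bsup>p-1\<^esup>\<close> can be replaced by \<open>(M i)\<^bsup>p-1\<^esup>\<close>.\<close>
      have M: "ennreal s \<le> M i" if "sec z s \<in> E i" for i
      proof -
        have "ennreal s = (\<integral>\<^sup>+ t. indicator {0<..<s} t \<partial>lborel)"
          using s by simp
        also have "\<dots> \<le> M i"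
          unfolding M_def
        proof (rule nn_integral_mono)
          fix t
          show "indicator {0<..<s} t \<le> indicator (E i) (sec z t) * (indicator {0<..<x} t :: ennreal)"
          proof (cases "0 < t \<and> t < s")
            case True
            then have "sec z t \<in> quadrant" "sec z t \<le> sec z s"
              using z by (auto intro: sec_quadrant sec_mono)
            then have "sec z t \<in> E i"
              using E[of i] that by (auto simp: decreasing_set_iff)
            then show ?thesis using True s by simp
          qed auto
        qed
        finally show ?thesis .
      qed
      have "g s * ennpowr (F s) (p - 1) = h (sec z s) * ennpowr (ennreal s) (p - 1)"
        using s p by (simp add: g_def h F ennpowr_mult ac_simps)
      also have "h (sec z s) \<le> 2 * (\<Sum>i<m. L i * indicator {t. L i < t} (h (sec z s)))"
        unfolding L_def using lev w by (intro dyadic_levels_ge) auto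
      also have "(\<Sum>i<m. L i * indicator {t. L i < t} (h (sec z s))) = (\<Sum>i<m. L i * indicator (E i) (sec z s))"
        using w by (intro sum.cong) (auto simp: E_def split: split_indicator)
      also have "2 * (\<Sum>i<m. L i * indicator (E i) (sec z s)) * ennpowr (ennreal s) (p - 1)
          = 2 * (\<Sum>i<m. L i * ennpowr (ennreal s) (p - 1) * indicator (E i) (sec z s))"
        by (simp only: sum_distrib_right mult.assoc) (simp only: ac_simps)
      also have "\<dots> \<le> 2 * (\<Sum>i<m. L i * ennpowr (M i) (p - 1) * indicator (E i) (sec z s))"
        using M p by (intro mult_left_mono sum_mono) (auto split: split_indicator intro!: mult_left_mono ennpowr_mono)
      finally show ?thesis using True by (simp add: mult_right_mono)
    qed auto
  qed
  \<comment> \<open>The remaining integral in each term is again \<open>M i\<close>, which completes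
    the power \<open>p - 1\<close> to \<open>p\<close>.\<close>
  also have "\<dots> = 2 * (\<Sum>i<m. (L i * ennpowr (M i) (p - 1)) * M i)"
    using E_meas by (simp add: nn_integral_cmult nn_integral_sum M_def)
  also have "\<dots> = 2 * (\<Sum>i<m. L i * ennpowr (M i) p)"
    using ennpowr_add[of _ "p - 1" 1] by (simp add: mult.assoc)
  finally have *: "ennpowr (F x) p \<le> ennreal (2 powr p) * (2 * (\<Sum>i<m. L i * ennpowr (M i) p))"
    by (simp add: mult_left_mono)
  have T_E: "T (indicator (E i)) z = ennreal (1 / x) * M i" for i
    by (simp add: T_eq M_def nn_integral_completion x_def)
  have "T f z = ennreal (1 / x) * F x"
    using x by (simp add: F x_def sec_coord mult.assoc[symmetric] flip: ennreal_mult)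
  then have "ennpowr (T f z) p = ennpowr (ennreal (1 / x)) p * ennpowr (F x) p"
    using p by (simp add: ennpowr_mult)
  also have "\<dots> \<le> ennpowr (ennreal (1 / x)) p * (ennreal (2 powr p) * (2 * (\<Sum>i<m. L i * ennpowr (M i) p)))"
    by (intro mult_left_mono *) auto
  also have "\<dots> = ennreal (2 powr p) * (2 * (\<Sum>i<m. L i * ennpowr (T (indicator (E i)) z) p))"
    using p by (simp add: T_E ennpowr_mult sum_distrib_left ac_simps)
  also have "\<dots> = ennreal (2 * 2 powr p) * (\<Sum>i<m. L i * ennpowr (T (indicator (E i)) z) p)"
    by (subst ennreal_mult) (auto simp: ac_simps)
  finally show ?thesis
    by (simp add: L_def E_def)
qed

end

section \<open>Boundedness from testing on decreasing sets\<close>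

text \<open>\<open>\<nu>\<close> stands for the weighted measure \<open>u dx dy\<close>, so that the
  weight disappears from the estimates; \<open>test\<close> is the desired inequality on
  characteristic functions only.\<close>

locale tested_average = section_average +
  fixes \<nu> :: "(real \<times> real) measure" and p k :: real
  assumes sets_\<nu>: "sets \<nu> = sets (lebesgue_on quadrant)"
    and p: "0 < p" and k: "0 < k"
    and test: "decreasing_set D \<Longrightarrow> (\<integral>\<^sup>+ z. ennpowr (T (indicator D) z) p \<partial>\<nu>) \<le> ennreal k * emeasure \<nu> D"
begin

lemma space_\<nu>: "space \<nu> = quadrant"
  using sets_eq_imp_space_eq[OF sets_\<nu>] by simp

lemma antimono_measurable:
  assumes "antimono_on quadrant (f :: real \<times> real \<Rightarrow> ennreal)"
  shows "f \<in> borel_measurable \<nu>"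
  using antimono_on_quadrant_measurable[OF assms] measurable_cong_sets[OF sets_\<nu> refl] by auto

lemma antimono_ennpowr_measurable:
  assumes "antimono_on quadrant f"
  shows "(\<lambda>z. ennpowr (f z) q) \<in> borel_measurable \<nu>"
  by (rule measurable_compose[OF antimono_measurable[OF assms] borel_measurable_ennpowr])

lemma decreasing_set_sets_\<nu>:
  assumes "decreasing_set D"
  shows "D \<in> sets \<nu>"
  using assms decreasing_set_lebesgue[OF assms]
  by (auto simp: sets_\<nu> sets_restrict_space_iff decreasing_set_def)

text \<open>A discrete layer-cake estimate: \<open>dyadic_levels_le\<close> at every point, then
  integration. It is used with \<open>q = p\<close> for \<open>f\<close> and with
  \<open>q = 1\<close> for \<open>h\<close>.\<close>

lemma sum_levels_le:
  assumes "0 < a" "0 < q" "antimono_on quadrant h"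
  shows "(\<Sum>i<m. ennpowr (ennreal (a * 2 ^ i)) q * emeasure \<nu> {w \<in> quadrant. ennreal (a * 2 ^ i) < h w})
    \<le> ennreal (1 / (1 - 2 powr - q)) * (\<integral>\<^sup>+ z. ennpowr (h z) q \<partial>\<nu>)"
proof -
  define E where "E i = {w \<in> quadrant. ennreal (a * 2 ^ i) < h w}" for i :: nat
  have E: "E i \<in> sets \<nu>" for i
    unfolding E_def by (intro decreasing_set_sets_\<nu> decreasing_set_superlevel assms)
  have "(\<Sum>i<m. ennpowr (ennreal (a * 2 ^ i)) q * emeasure \<nu> (E i))
      = (\<integral>\<^sup>+ z. (\<Sum>i<m. ennpowr (ennreal (a * 2 ^ i)) q * indicator (E i) z) \<partial>\<nu>)"
    using E by (subst nn_integral_sum) (auto simp: nn_integral_cmult_indicator)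
  also have "\<dots> \<le> (\<integral>\<^sup>+ z. ennreal (1 / (1 - 2 powr - q)) * ennpowr (h z) q \<partial>\<nu>)"
  proof (rule nn_integral_mono)
    fix z assume "z \<in> space \<nu>"
    then have "(\<Sum>i<m. ennpowr (ennreal (a * 2 ^ i)) q * indicator (E i) z)
        = (\<Sum>i<m. ennpowr (ennreal (a * 2 ^ i)) q * indicator {s. ennreal (a * 2 ^ i) < s} (h z))"
      by (intro sum.cong) (auto simp: E_def space_\<nu> split: split_indicator)
    also have "\<dots> \<le> ennreal (1 / (1 - 2 powr - q)) * ennpowr (h z) q"
      by (rule dyadic_levels_le[OF assms(1,2)])
    finally show "(\<Sum>i<m. ennpowr (ennreal (a * 2 ^ i)) q * indicator (E i) z)
        \<le> ennreal (1 / (1 - 2 powr - q)) * ennpowr (h z) q" .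
  qed
  also have "\<dots> = ennreal (1 / (1 - 2 powr - q)) * (\<integral>\<^sup>+ z. ennpowr (h z) q \<partial>\<nu>)"
    using antimono_ennpowr_measurable[OF assms(3)] by (rule nn_integral_cmult)
  finally show ?thesis by (simp add: E_def)
qed

text \<open>The testing inequality is summed over levels. The coefficients \<open>c\<close> stay
  arbitrary because they are \<open>p\<close>-th powers of levels when \<open>p \<le> 1\<close> and
  the levels themselves when \<open>p > 1\<close>.\<close>

lemma sum_levels_test:
  fixes h :: "real \<times> real \<Rightarrow> ennreal"
  assumes "antimono_on quadrant h"
  shows "(\<integral>\<^sup>+ z. (\<Sum>i<m. c i * ennpowr (T (indicator {w \<in> quadrant. l i < h w}) z) p) \<partial>\<nu>)
    \<le> ennreal k * (\<Sum>i<m. c i * emeasure \<nu> {w \<in> quadrant. l i < h w})"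
proof -
  have D: "decreasing_set {w \<in> quadrant. l i < h w}" for i
    by (rule decreasing_set_superlevel[OF assms])
  have "(\<lambda>z. ennpowr (T (indicator {w \<in> quadrant. l i < h w}) z) p) \<in> borel_measurable \<nu>" for i
    by (intro antimono_ennpowr_measurable T_antimono antimono_on_indicator D)
  then have "(\<integral>\<^sup>+ z. (\<Sum>i<m. c i * ennpowr (T (indicator {w \<in> quadrant. l i < h w}) z) p) \<partial>\<nu>)
      = (\<Sum>i<m. c i * (\<integral>\<^sup>+ z. ennpowr (T (indicator {w \<in> quadrant. l i < h w}) z) p \<partial>\<nu>))"
    by (simp add: nn_integral_sum nn_integral_cmult)
  also have "\<dots> \<le> (\<Sum>i<m. c i * (ennreal k * emeasure \<nu> {w \<in> quadrant. l i < h w}))"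
    by (intro sum_mono mult_left_mono test D) auto
  finally show ?thesis
    by (simp add: sum_distrib_left ac_simps)
qed

text \<open>The constant is a product of three losses: \<open>2 powr p\<close> from rounding to
  dyadic levels, \<open>k\<close> from testing, and the geometric series from reassembling the
  levels.\<close>

lemma simple_bound_le_1:
  assumes p1: "p \<le> 1" and f: "antimono_on quadrant f"
    and a: "0 < a" "\<And>w. w \<in> quadrant \<Longrightarrow> f w = 0 \<or> ennreal a < f w"
    and b: "\<And>w. w \<in> quadrant \<Longrightarrow> f w \<le> ennreal b"
  shows "(\<integral>\<^sup>+ z. ennpowr (T f z) p \<partial>\<nu>)
    \<le> ennreal (2 powr p * k * (1 / (1 - 2 powr - p))) * (\<integral>\<^sup>+ z. ennpowr (f z) p \<partial>\<nu>)"
proof -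
  \<comment> \<open>Enough levels for \<open>a * 2 ^ m\<close> to exceed the upper bound of
    \<open>f\<close>.\<close>
  obtain m where "b / a < 2 ^ m"
    using real_arch_pow[of 2 "b / a"] by auto
  then have m: "b \<le> a * 2 ^ m"
    using a by (simp add: field_simps)
  define L where "L i = ennreal (a * 2 ^ i)" for i :: nat
  define E where "E i = {w \<in> quadrant. L i < f w}" for i
  have E: "antimono_on quadrant (indicator (E i) :: _ \<Rightarrow> ennreal)" for i
    unfolding E_def by (intro antimono_on_indicator decreasing_set_superlevel f)
  have "(\<integral>\<^sup>+ z. ennpowr (T f z) p \<partial>\<nu>)
      \<le> (\<integral>\<^sup>+ z. (\<Sum>i<m. ennpowr (2 * L i) p * ennpowr (T (indicator (E i)) z) p) \<partial>\<nu>)"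
  proof (rule nn_integral_mono)
    fix z assume "z \<in> space \<nu>"
    then have z: "z \<in> quadrant" by (simp add: space_\<nu>)
    have "f w \<le> (\<Sum>i<m. 2 * L i * indicator (E i) w)" if w: "w \<in> quadrant" for w
    proof -
      have "f w \<le> ennreal (a * 2 ^ m)"
        using b[OF w] m by (auto intro: order_trans ennreal_leI)
      then have "f w \<le> 2 * (\<Sum>i<m. L i * indicator {s. L i < s} (f w))"
        unfolding L_def using a w by (intro dyadic_levels_ge) auto
      also have "(\<Sum>i<m. L i * indicator {s. L i < s} (f w)) = (\<Sum>i<m. L i * indicator (E i) w)"
        using w by (intro sum.cong) (auto simp: E_def split: split_indicator)
      finally show ?thesis by (simp only: sum_distrib_left mult.assoc)
    qed
    then have "T f z \<le> T (\<lambda>w. \<Sum>i<m. 2 * L i * indicator (E i) w) z"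
      using z by (rule T_mono)
    also have "\<dots> = (\<Sum>i<m. T (\<lambda>w. 2 * L i * indicator (E i) w) z)"
      using E z by (intro T_sum) (auto intro!: monotone_onI mult_left_mono dest: monotone_onD)
    also have "\<dots> = (\<Sum>i<m. 2 * L i * T (indicator (E i)) z)"
      by (intro sum.cong T_cmult E z refl)
    finally have "ennpowr (T f z) p \<le> ennpowr (\<Sum>i<m. 2 * L i * T (indicator (E i)) z) p"
      using p by (intro ennpowr_mono) auto
    also have "\<dots> \<le> (\<Sum>i<m. ennpowr (2 * L i * T (indicator (E i)) z) p)"
      using p p1 by (intro ennpowr_sum_le) auto
    also have "\<dots> = (\<Sum>i<m. ennpowr (2 * L i) p * ennpowr (T (indicator (E i)) z) p)"
      using p by (simp add: ennpowr_mult)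
    finally show "ennpowr (T f z) p \<le> (\<Sum>i<m. ennpowr (2 * L i) p * ennpowr (T (indicator (E i)) z) p)" .
  qed
  also have "\<dots> \<le> ennreal k * (\<Sum>i<m. ennpowr (2 * L i) p * emeasure \<nu> (E i))"
    unfolding E_def by (rule sum_levels_test[OF f])
  also have "(\<Sum>i<m. ennpowr (2 * L i) p * emeasure \<nu> (E i)) = ennreal (2 powr p) * (\<Sum>i<m. ennpowr (L i) p * emeasure \<nu> (E i))"
    using p ennpowr_ennreal[of 2 p] by (simp add: ennpowr_mult sum_distrib_left mult.assoc)
  also have "(\<Sum>i<m. ennpowr (L i) p * emeasure \<nu> (E i))
      \<le> ennreal (1 / (1 - 2 powr - p)) * (\<integral>\<^sup>+ z. ennpowr (f z) p \<partial>\<nu>)"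
    unfolding L_def E_def by (rule sum_levels_le[OF a(1) p f])
  also have "ennreal k * (ennreal (2 powr p) * (ennreal (1 / (1 - 2 powr - p)) * (\<integral>\<^sup>+ z. ennpowr (f z) p \<partial>\<nu>)))
      = ennreal (2 powr p * k * (1 / (1 - 2 powr - p))) * (\<integral>\<^sup>+ z. ennpowr (f z) p \<partial>\<nu>)"
  proof -
    have *: "ennreal (2 powr p * k * c) = ennreal (2 powr p) * ennreal k * ennreal c" if "0 \<le> c" for c
      using that k by (simp add: ennreal_mult)
    have "0 \<le> 1 / (1 - 2 powr - p)"
      using p powr_less_mono[of "- p" 0 2] by simp
    then show ?thesis
      unfolding *[OF \<open>0 \<le> 1 / (1 - 2 powr - p)\<close>] by (simp only: ac_simps)
  qed
  finally show ?thesis by (simp add: mult_left_mono)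
qed

text \<open>A qualitative statement that permits the absorption for \<open>p > 1\<close>. Here
  \<open>f\<close> is dominated by \<open>b\<close> times the indicator of \<open>D\<close>, and
  \<open>D\<close> has finite measure by Chebyshev's inequality, so the testing hypothesis for
  \<open>D\<close> alone suffices.\<close>

lemma simple_finite:
  assumes f: "antimono_on quadrant f"
    and a: "0 < a" "\<And>w. w \<in> quadrant \<Longrightarrow> f w = 0 \<or> ennreal a < f w"
    and b: "\<And>w. w \<in> quadrant \<Longrightarrow> f w \<le> ennreal b"
    and fin: "(\<integral>\<^sup>+ z. ennpowr (f z) p \<partial>\<nu>) < top"
  shows "(\<integral>\<^sup>+ z. ennpowr (T f z) p \<partial>\<nu>) < top"
proof -
  define D where "D = {w \<in> quadrant. ennreal a < f w}"
  have D: "decreasing_set D"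
    unfolding D_def by (rule decreasing_set_superlevel[OF f])
  have "ennpowr (ennreal a) p * emeasure \<nu> D = (\<integral>\<^sup>+ z. ennpowr (ennreal a) p * indicator D z \<partial>\<nu>)"
    using decreasing_set_sets_\<nu>[OF D] by (simp add: nn_integral_cmult_indicator)
  also have "\<dots> \<le> (\<integral>\<^sup>+ z. ennpowr (f z) p \<partial>\<nu>)"
    using p by (intro nn_integral_mono) (auto simp: D_def split: split_indicator intro!: ennpowr_mono)
  also note fin
  finally have "emeasure \<nu> D < top"
    using a by (auto simp: ennreal_mult_less_top)
  have "(\<integral>\<^sup>+ z. ennpowr (T f z) p \<partial>\<nu>) \<le> (\<integral>\<^sup>+ z. ennpowr (ennreal b) p * ennpowr (T (indicator D) z) p \<partial>\<nu>)"
  proof (rule nn_integral_mono)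
    fix z assume "z \<in> space \<nu>"
    then have z: "z \<in> quadrant" by (simp add: space_\<nu>)
    have "f w \<le> ennreal b * indicator D w" if "w \<in> quadrant" for w
      using a(2)[OF that] b[OF that] that by (auto simp: D_def split: split_indicator)
    then have "T f z \<le> T (\<lambda>w. ennreal b * indicator D w) z"
      using z by (rule T_mono)
    also have "\<dots> = ennreal b * T (indicator D) z"
      by (rule T_cmult[OF antimono_on_indicator[OF D] z])
    finally show "ennpowr (T f z) p \<le> ennpowr (ennreal b) p * ennpowr (T (indicator D) z) p"
      using p ennpowr_mono[of "T f z" "ennreal b * T (indicator D) z" p] by (simp add: ennpowr_mult)
  qed
  also have "\<dots> = ennpowr (ennreal b) p * (\<integral>\<^sup>+ z. ennpowr (T (indicator D) z) p \<partial>\<nu>)"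
    by (intro nn_integral_cmult antimono_ennpowr_measurable T_antimono antimono_on_indicator D)
  also have "\<dots> \<le> ennpowr (ennreal b) p * (ennreal k * emeasure \<nu> D)"
    by (intro mult_left_mono test D) auto
  also have "\<dots> < top"
    using \<open>emeasure \<nu> D < top\<close> by (simp add: ennreal_mult_less_top)
  finally show ?thesis .
qed

text \<open>Level decomposition and testing bound \<open>X\<close> by \<open>B\<close> times the
  integral of \<open>h\<close>; a Young inequality splits the latter into a multiple of
  \<open>Y\<close> and a small multiple of \<open>X\<close>. In \<open>B\<close>, the factor 4 is 2
  from \<open>T_powr_le_levels\<close> times 2 from the geometric series.\<close>

lemma simple_bound_gt_1:
  assumes p1: "1 < p" and f: "antimono_on quadrant f"
    and a: "0 < a" "\<And>w. w \<in> quadrant \<Longrightarrow> f w = 0 \<or> ennreal a < f w"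
    and b: "\<And>w. w \<in> quadrant \<Longrightarrow> f w \<le> ennreal b"
    and fin: "(\<integral>\<^sup>+ z. ennpowr (f z) p \<partial>\<nu>) < top"
  defines "B \<equiv> 4 * 2 powr p * k"
  shows "(\<integral>\<^sup>+ z. ennpowr (T f z) p \<partial>\<nu>)
    \<le> ennreal (2 * B * (2 * B) powr (p - 1)) * (\<integral>\<^sup>+ z. ennpowr (f z) p \<partial>\<nu>)"
proof -
  define X where "X = (\<integral>\<^sup>+ z. ennpowr (T f z) p \<partial>\<nu>)"
  define Y where "Y = (\<integral>\<^sup>+ z. ennpowr (f z) p \<partial>\<nu>)"
  have B: "0 < B" using k by (simp add: B_def)
  define h where "h w = f w * ennpowr (T f w) (p - 1)" for w
  \<comment> \<open>Wherever \<open>f\<close> is nonzero, \<open>h\<close> is at least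
    \<open>a powr p\<close>. Halving turns this into the strict bound that the dyadic levels
    require.\<close>
  define \<alpha> where "\<alpha> = a powr p / 2"
  have \<alpha>: "0 < \<alpha>" using a by (simp add: \<alpha>_def)
  define b' where "b' = max b 0"
  have b': "f w \<le> ennreal b'" if "w \<in> quadrant" for w
    using b[OF that] by (rule order_trans) (simp add: b'_def ennreal_leI)
  obtain m where "b' powr p / \<alpha> < 2 ^ m"
    using real_arch_pow[of 2 "b' powr p / \<alpha>"] by auto
  then have m: "b' powr p \<le> \<alpha> * 2 ^ m"
    using \<alpha> by (simp add: field_simps)
  have h_anti: "antimono_on quadrant h"
    unfolding h_def using p1
    by (intro monotone_onI mult_mono ennpowr_mono monotone_onD[OF f] monotone_onD[OF T_antimono[OF f]]) auto
  have powr1: "ennreal t * ennpowr (ennreal t) (p - 1) = ennreal (t powr p)" if "0 \<le> t" for t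
    using ennpowr_add[of "ennreal t" 1 "p - 1"] that by simp
  have h_low: "h w = 0 \<or> ennreal \<alpha> < h w" if w: "w \<in> quadrant" for w
  proof (cases "f w = 0")
    case False
    then have fa: "ennreal a \<le> f w" using a(2)[OF w] by auto
    have "ennreal \<alpha> < ennreal (a powr p)"
      using a by (simp add: \<alpha>_def ennreal_less_iff)
    also have "\<dots> = ennreal a * ennpowr (ennreal a) (p - 1)"
      using powr1[of a] a by simp
    also have "\<dots> \<le> h w"
      unfolding h_def using fa p1 le_T[OF f w] by (intro mult_mono ennpowr_mono) auto
    finally show ?thesis by simp
  qed (simp add: h_def)
  have h_high: "h w \<le> ennreal (\<alpha> * 2 ^ m)" if w: "w \<in> quadrant" for w
  proof -
    have "h w \<le> ennreal b' * ennpowr (ennreal b') (p - 1)"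
      unfolding h_def using p1 w by (intro mult_mono ennpowr_mono b' T_const_le) auto
    also have "\<dots> = ennreal (b' powr p)"
      by (rule powr1) (simp add: b'_def)
    also have "\<dots> \<le> ennreal (\<alpha> * 2 ^ m)"
      using m by (rule ennreal_leI)
    finally show ?thesis .
  qed
  define L where "L i = ennreal (\<alpha> * 2 ^ i)" for i :: nat
  define E where "E i = {w \<in> quadrant. L i < h w}" for i
  have E: "decreasing_set (E i)" for i
    unfolding E_def by (rule decreasing_set_superlevel[OF h_anti])
  have "X \<le> (\<integral>\<^sup>+ z. ennreal (2 * 2 powr p) * (\<Sum>i<m. L i * ennpowr (T (indicator (E i)) z) p) \<partial>\<nu>)"
    unfolding X_def L_def E_def
    by (intro nn_integral_mono T_powr_le_levels[OF p1 f b h_def \<alpha> h_low h_high h_anti])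
      (auto simp: space_\<nu>)
  also have "\<dots> = ennreal (2 * 2 powr p) * (\<integral>\<^sup>+ z. (\<Sum>i<m. L i * ennpowr (T (indicator (E i)) z) p) \<partial>\<nu>)"
    by (intro nn_integral_cmult borel_measurable_sum borel_measurable_times_ennreal
        antimono_ennpowr_measurable T_antimono antimono_on_indicator E) auto
  also have "\<dots> \<le> ennreal (2 * 2 powr p) * (ennreal k * (\<Sum>i<m. L i * emeasure \<nu> (E i)))"
    unfolding E_def by (intro mult_left_mono sum_levels_test[OF h_anti]) auto
  \<comment> \<open>With exponent \<open>q = 1\<close> the geometric constant is
    \<open>1 / (1 - 1 / 2) = 2\<close>.\<close>
  also have "(\<Sum>i<m. L i * emeasure \<nu> (E i)) \<le> 2 * (\<integral>\<^sup>+ z. h z \<partial>\<nu>)"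
    using sum_levels_le[OF \<alpha> _ h_anti, of 1 m] by (simp add: L_def E_def powr_minus)
  \<comment> \<open>The parameter \<open>R = 2 * B\<close> is chosen so that, after multiplication
    by \<open>B\<close>, the coefficient of \<open>X\<close> is exactly one half.\<close>
  also have "(\<integral>\<^sup>+ z. h z \<partial>\<nu>) \<le> (\<integral>\<^sup>+ z. ennreal ((2 * B) powr (p - 1)) * ennpowr (f z) p
      + ennreal (1 / (2 * B)) * ennpowr (T f z) p \<partial>\<nu>)"
    unfolding h_def using p1 B by (intro nn_integral_mono mult_ennpowr_le) auto
  also have "\<dots> = ennreal ((2 * B) powr (p - 1)) * Y + ennreal (1 / (2 * B)) * X"
    using antimono_ennpowr_measurable[OF f] antimono_ennpowr_measurable[OF T_antimono[OF f]]
    by (simp add: nn_integral_add nn_integral_cmult X_def Y_def)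
  finally have X_le: "X \<le> ennreal (2 * 2 powr p) * (ennreal k * (2 *
      (ennreal ((2 * B) powr (p - 1)) * Y + ennreal (1 / (2 * B)) * X)))"
    by (simp add: mult_left_mono)
  \<comment> \<open>Subtracting \<open>X / 2\<close> from both sides is legitimate only for finite
    \<open>X\<close>.\<close>
  have "X < top"
    unfolding X_def by (rule simple_finite[OF f a b fin])
  then obtain x where x: "X = ennreal x" "0 \<le> x" by (cases X) auto
  obtain y where y: "Y = ennreal y" "0 \<le> y" using fin by (cases Y) (auto simp: Y_def)
  define \<beta> where "\<beta> = (2 * B) powr (p - 1)"
  define \<gamma> where "\<gamma> = 1 / (2 * B)"
  have "0 \<le> \<beta>" "0 \<le> \<gamma>" using B by (auto simp: \<beta>_def \<gamma>_def)
  then have "ennreal (2 * 2 powr p) * (ennreal k * (2 * (ennreal \<beta> * Y + ennreal \<gamma> * X)))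
      = ennreal (2 * 2 powr p * (k * (2 * (\<beta> * y + \<gamma> * x))))"
    using x y k by (simp add: ennreal_mult)
  then have "x \<le> 2 * 2 powr p * (k * (2 * (\<beta> * y + \<gamma> * x)))"
    using X_le x y k \<open>0 \<le> \<beta>\<close> \<open>0 \<le> \<gamma>\<close> by (simp add: ennreal_le_iff flip: \<beta>_def \<gamma>_def)
  also have "\<dots> = B * (2 * B) powr (p - 1) * y + x / 2"
  proof -
    have "2 * 2 powr p * (k * (2 * (\<beta> * y + \<gamma> * x))) = B * \<beta> * y + B * \<gamma> * x"
      by (simp add: B_def algebra_simps)
    also have "B * \<gamma> = 1 / 2" using B by (simp add: \<gamma>_def)
    finally show ?thesis by (simp add: \<beta>_def)
  qed
  finally have "x \<le> 2 * B * (2 * B) powr (p - 1) * y" by simp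
  then have "X \<le> ennreal (2 * B * (2 * B) powr (p - 1) * y)"
    using x by (simp add: ennreal_leI)
  also have "\<dots> = ennreal (2 * B * (2 * B) powr (p - 1)) * Y"
    using B y by (simp add: ennreal_mult)
  finally show ?thesis by (simp add: X_def Y_def)
qed

text \<open>The constants for simple functions depend on \<open>p\<close> and \<open>k\<close> only,
  not on the lower and upper bounds of the function, so truncation and monotone convergence remove
  those bounds.\<close>

lemma T_bounded:
  obtains C where "0 \<le> C" "\<And>f. antimono_on quadrant f \<Longrightarrow> (\<integral>\<^sup>+ z. ennpowr (f z) p \<partial>\<nu>) < top \<Longrightarrow>
    (\<integral>\<^sup>+ z. ennpowr (T f z) p \<partial>\<nu>) \<le> ennreal C * (\<integral>\<^sup>+ z. ennpowr (f z) p \<partial>\<nu>)"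
proof -
  define B where "B = 4 * 2 powr p * k"
  define C where "C = (if p \<le> 1 then 2 powr p * k * (1 / (1 - 2 powr - p)) else 2 * B * (2 * B) powr (p - 1))"
  have C: "0 \<le> C"
    using k p powr_less_mono[of "- p" 0 2] by (simp add: C_def B_def)
  have "(\<integral>\<^sup>+ z. ennpowr (T f z) p \<partial>\<nu>) \<le> ennreal C * (\<integral>\<^sup>+ z. ennpowr (f z) p \<partial>\<nu>)"
    if f: "antimono_on quadrant f" and fin: "(\<integral>\<^sup>+ z. ennpowr (f z) p \<partial>\<nu>) < top" for f
  proof -
    \<comment> \<open>Small values are cut to 0 and large ones capped, which preserves monotonicity.
      The shift by 2 keeps the cap strictly above the threshold even for \<open>n = 0\<close>, so
      nonzero values of \<open>F n\<close> still exceed the threshold.\<close>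
    define F where "F n z = (if ennreal (1 / real (n + 2)) < f z then min (f z) (ennreal (real (n + 2))) else 0)" for n z
    have F_le: "F n z \<le> f z" for n z
      by (simp add: F_def)
    have F_anti: "antimono_on quadrant (F n)" for n
      using monotone_onD[OF f] by (intro monotone_onI) (force simp: F_def min_le_iff_disj not_less)
    have F_inc: "incseq (\<lambda>n. F n z)" for z
    proof (rule incseq_SucI)
      fix n
      have "ennreal (1 / real (Suc n + 2)) \<le> ennreal (1 / real (n + 2))"
        by (intro ennreal_leI) (simp add: field_simps)
      then have lo: "ennreal (1 / real (Suc n + 2)) < f z" if "ennreal (1 / real (n + 2)) < f z"
        using that by (rule le_less_trans)
      show "F n z \<le> F (Suc n) z"
      proof (cases "ennreal (1 / real (n + 2)) < f z")
        case True
        have "min (f z) (ennreal (real (n + 2))) \<le> min (f z) (ennreal (real (Suc n + 2)))"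
          by (intro min.mono ennreal_leI) auto
        with True lo[OF True] show ?thesis
          by (simp only: F_def if_True)
      next
        case False
        then have "F n z = 0" by (simp only: F_def if_False)
        then show ?thesis by simp
      qed
    qed
    have F_SUP: "(SUP n. F n z) = f z" for z
    proof (rule SUP_eqI)
      fix v assume v: "\<And>n. n \<in> UNIV \<Longrightarrow> F n z \<le> v"
      show "f z \<le> v"
      proof (cases "f z = 0 \<or> v = top")
        case False
        then obtain r where r: "v = ennreal r" "0 \<le> r" by (cases v) auto
        obtain q where q: "0 < q" "ennreal q < f z"
        proof (cases "f z")
          case (real s)
          then show thesis using False that[of "s / 2"] by (auto simp: ennreal_less_iff)
        next
          case top
          then show thesis using that[of 1] by simp
        qed
        \<comment> \<open>Such an \<open>n\<close> puts the threshold below \<open>q\<close>, hence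
          below \<open>f z\<close>, and the cap above \<open>r\<close>; the minimum bounded by
          \<open>r\<close> must then be \<open>f z\<close> itself.\<close>
        obtain n where n: "max r (1 / q) < real n"
          using reals_Archimedean2 by blast
        then have "1 / q < real (n + 2)" by simp
        then have "1 / real (n + 2) < q"
          using q by (simp add: field_simps)
        then have "ennreal (1 / real (n + 2)) < f z"
          using q(2) ennreal_leI[OF less_imp_le] le_less_trans by blast
        then have "min (f z) (ennreal (real (n + 2))) \<le> ennreal r"
          using v[of n] r by (simp add: F_def)
        moreover have "ennreal r < ennreal (real (n + 2))"
          using n r by (intro ennreal_lessI) auto
        ultimately show ?thesis using r by (auto simp: min_le_iff_disj)
      qed auto
    qed (rule F_le)
    have F_val: "F n w = 0 \<or> ennreal (1 / real (n + 2)) < F n w" "F n w \<le> ennreal (real (n + 2))" for n w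
    proof -
      have "ennreal (1 / real (n + 2)) < ennreal (real (n + 2))"
        by (rule ennreal_lessI, simp, rule less_trans[of _ 1]) auto
      then show "F n w = 0 \<or> ennreal (1 / real (n + 2)) < F n w"
        by (simp add: F_def)
    qed (simp add: F_def)
    have F_int: "(\<integral>\<^sup>+ z. ennpowr (F n z) p \<partial>\<nu>) \<le> (\<integral>\<^sup>+ z. ennpowr (f z) p \<partial>\<nu>)" for n
      using p F_le by (intro nn_integral_mono ennpowr_mono) auto
    have bound: "(\<integral>\<^sup>+ z. ennpowr (T (F n) z) p \<partial>\<nu>) \<le> ennreal C * (\<integral>\<^sup>+ z. ennpowr (f z) p \<partial>\<nu>)" for n
    proof -
      have "(\<integral>\<^sup>+ z. ennpowr (T (F n) z) p \<partial>\<nu>) \<le> ennreal C * (\<integral>\<^sup>+ z. ennpowr (F n z) p \<partial>\<nu>)"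
      proof (cases "p \<le> 1")
        case True
        then show ?thesis
          unfolding C_def using simple_bound_le_1[OF True F_anti _ F_val] by simp
      next
        case False
        then show ?thesis
          unfolding C_def B_def using simple_bound_gt_1[OF _ F_anti _ F_val le_less_trans[OF F_int fin]] by simp
      qed
      also have "\<dots> \<le> ennreal C * (\<integral>\<^sup>+ z. ennpowr (f z) p \<partial>\<nu>)"
        by (intro mult_left_mono F_int) auto
      finally show ?thesis .
    qed
    have "(\<integral>\<^sup>+ z. ennpowr (T f z) p \<partial>\<nu>) = (\<integral>\<^sup>+ z. (SUP n. ennpowr (T (F n) z) p) \<partial>\<nu>)"
    proof (intro nn_integral_cong)
      fix z assume "z \<in> space \<nu>"
      then have "T (\<lambda>w. SUP n. F n w) z = (SUP n. T (F n) z)"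
        by (intro T_SUP F_anti F_inc) (simp add: space_\<nu>)
      then show "ennpowr (T f z) p = (SUP n. ennpowr (T (F n) z) p)"
        using p by (simp add: F_SUP ennpowr_SUP)
    qed
    also have "\<dots> = (\<integral>\<^sup>+ z. (SUP n. if z \<in> quadrant then ennpowr (T (F n) z) p else 0) \<partial>\<nu>)"
      by (intro nn_integral_cong) (simp add: space_\<nu>)
    \<comment> \<open>Monotone convergence asks for an increasing sequence at every point of the
      plane, whereas monotonicity of \<open>T\<close> is known on \<open>quadrant\<close>
      only.\<close>
    also have "\<dots> = (SUP n. \<integral>\<^sup>+ z. (if z \<in> quadrant then ennpowr (T (F n) z) p else 0) \<partial>\<nu>)"
    proof (rule nn_integral_monotone_convergence_SUP)
      show "incseq (\<lambda>n z. if z \<in> quadrant then ennpowr (T (F n) z) p else 0)"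
        using p F_inc by (auto simp: incseq_def le_fun_def intro!: ennpowr_mono T_mono)
      have "(\<lambda>z. if z \<in> quadrant then ennpowr (T (F n) z) p else 0) \<in> borel_measurable \<nu>
          \<longleftrightarrow> (\<lambda>z. ennpowr (T (F n) z) p) \<in> borel_measurable \<nu>" for n
        by (intro measurable_cong) (simp add: space_\<nu>)
      then show "(\<lambda>z. if z \<in> quadrant then ennpowr (T (F n) z) p else 0) \<in> borel_measurable \<nu>" for n
        using antimono_ennpowr_measurable[OF T_antimono[OF F_anti]] by simp
    qed
    also have "\<dots> \<le> ennreal C * (\<integral>\<^sup>+ z. ennpowr (f z) p \<partial>\<nu>)"
    proof (rule SUP_least)
      fix n
      have "(\<integral>\<^sup>+ z. (if z \<in> quadrant then ennpowr (T (F n) z) p else 0) \<partial>\<nu>) = (\<integral>\<^sup>+ z. ennpowr (T (F n) z) p \<partial>\<nu>)"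
        by (intro nn_integral_cong) (simp add: space_\<nu>)
      then show "(\<integral>\<^sup>+ z. (if z \<in> quadrant then ennpowr (T (F n) z) p else 0) \<partial>\<nu>) \<le> ennreal C * (\<integral>\<^sup>+ z. ennpowr (f z) p \<partial>\<nu>)"
        using bound by simp
    qed
    finally show ?thesis .
  qed
  with C that show thesis by blast
qed

end

section \<open>Hardy operators on the quadrant\<close>

interpretation S1: section_average S1 fst "\<lambda>z s. (s, snd z)"
  by unfold_locales (auto simp: S1_def split_beta less_eq_prod_def quadrant_iff)

interpretation S2: section_average S2 snd "\<lambda>z s. (fst z, s)"
  by unfold_locales (auto simp: S2_def split_beta less_eq_prod_def quadrant_iff)

text \<open>The inner integral in the definition of \<open>S\<close> is \<open>y\<close> times
  \<open>S2 f\<close>. Monotonicity of \<open>S2 f\<close> gives the measurability that allows the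
  factor \<open>y\<close> to be taken out of the outer integral.\<close>

lemma S_eq_S1_S2:
  assumes f: "antimono_on quadrant f" and z: "z \<in> quadrant"
  shows "S f z = S1 (S2 f) z"
proof (cases z)
  case (Pair x y)
  then have xy: "0 < x" "0 < y" using z by auto
  have inner: "(\<integral>\<^sup>+ t \<in> {0<..<y}. f (s, t) \<partial>lebesgue) = ennreal y * S2 f (s, y)" for s
    using xy by (simp add: S2_def mult.assoc[symmetric] flip: ennreal_mult)
  have "(\<integral>\<^sup>+ s. (ennreal y * S2 f (s, y)) * indicator {0<..<x} s \<partial>lborel)
      = (\<integral>\<^sup>+ s. ennreal y * (S2 f (s, y) * indicator {0<..<x} s) \<partial>lborel)"
    by (simp add: mult.assoc)
  also have "\<dots> = ennreal y * (\<integral>\<^sup>+ s. S2 f (s, y) * indicator {0<..<x} s \<partial>lborel)"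
    using S1.section_borel[OF S2.T_antimono[OF f] z, of x] Pair by (intro nn_integral_cmult) auto
  finally have "S f z = ennreal (1 / (x * y)) * (ennreal y * (\<integral>\<^sup>+ s. S2 f (s, y) * indicator {0<..<x} s \<partial>lborel))"
    by (simp only: S_def Pair prod.case inner) (simp only: nn_integral_completion)
  also have "\<dots> = ennreal (1 / (x * y) * y) * (\<integral>\<^sup>+ s. S2 f (s, y) * indicator {0<..<x} s \<partial>lborel)"
    using xy by (subst ennreal_mult) (auto simp: mult.assoc)
  also have "1 / (x * y) * y = 1 / x"
    using xy by simp
  finally show ?thesis
    by (simp add: Pair S1_def nn_integral_completion)
qed

lemma corner_le_S:
  assumes "decreasing_set D" "0 < x" "0 < y"
  shows "ennreal (measure lebesgue (corner D x y) / (x * y)) \<le> S (indicator D) (x, y)"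
proof -
  have "ennreal (measure lebesgue (corner D x y) / (x * y))
      = ennreal (1 / (x * y)) * ennreal (measure lebesgue (corner D x y))"
    using assms by (subst ennreal_mult[symmetric]) auto
  also have "\<dots> \<le> S (indicator D) (x, y)"
    unfolding S_def corner_lebesgue(2)[OF assms(1)]
    using emeasure_corner_le[OF assms(1)] by (auto intro: mult_left_mono)
  finally show ?thesis .
qed

text \<open>If \<open>(s, y)\<close> lies in \<open>D\<close>, so does the vertical segment below
  it. The strip \<open>E \<times> {0<..y}\<close> therefore fits into the corner, and its area is
  \<open>x * y\<close> times the average on the left.\<close>

lemma S1_indicator_le_corner:
  assumes D: "decreasing_set D" and xy: "0 < x" "0 < y"
  shows "S1 (indicator D) (x, y) \<le> ennreal (measure lebesgue (corner D x y) / (x * y))"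
proof -
  define E where "E = {s. (s, y) \<in> D} \<inter> {0<..<x}"
  have E: "E \<in> sets borel"
    unfolding E_def by (intro sets.Int decreasing_set_section_borel D) auto
  have "E \<times> {0<..y} \<subseteq> corner D x y"
    using decreasing_setD(3)[OF D] by (fastforce simp: E_def corner_def)
  then have "emeasure lebesgue (E \<times> {0<..y}) \<le> ennreal (measure lebesgue (corner D x y))"
    unfolding corner_lebesgue(2)[OF D] using corner_lebesgue(1)[OF D] by (rule emeasure_mono)
  then have le: "emeasure lborel E * ennreal y \<le> ennreal (measure lebesgue (corner D x y))"
    using xy E by (simp add: emeasure_Times_lebesgue)
  have "S1 (indicator D) (x, y) = ennreal (1 / x) * (\<integral>\<^sup>+ s. indicator E s \<partial>lborel)"
    unfolding S1_def nn_integral_completion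
    by (auto simp: E_def intro!: arg_cong2[where f = times] nn_integral_cong split: split_indicator)
  also have "\<dots> = ennreal (1 / (x * y) * y) * emeasure lborel E"
    using xy E by simp
  also have "\<dots> = ennreal (1 / (x * y)) * (emeasure lborel E * ennreal y)"
    using xy by (subst ennreal_mult) (auto simp: ac_simps)
  also have "\<dots> \<le> ennreal (1 / (x * y)) * ennreal (measure lebesgue (corner D x y))"
    by (intro mult_left_mono le) auto
  also have "\<dots> = ennreal (measure lebesgue (corner D x y) / (x * y))"
    using xy by (subst ennreal_mult[symmetric]) auto
  finally show ?thesis .
qed

text \<open>The same argument with horizontal strips.\<close>

lemma S2_indicator_le_corner:
  assumes D: "decreasing_set D" and xy: "0 < x" "0 < y"
  shows "S2 (indicator D) (x, y) \<le> ennreal (measure lebesgue (corner D x y) / (x * y))"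
proof -
  define E where "E = {t. (x, t) \<in> D} \<inter> {0<..<y}"
  have E: "E \<in> sets borel"
    unfolding E_def by (intro sets.Int decreasing_set_section_borel D) auto
  have "{0<..x} \<times> E \<subseteq> corner D x y"
    using decreasing_setD(3)[OF D] by (fastforce simp: E_def corner_def)
  then have "emeasure lebesgue ({0<..x} \<times> E) \<le> ennreal (measure lebesgue (corner D x y))"
    unfolding corner_lebesgue(2)[OF D] using corner_lebesgue(1)[OF D] by (rule emeasure_mono)
  then have le: "ennreal x * emeasure lborel E \<le> ennreal (measure lebesgue (corner D x y))"
    using xy E by (simp add: emeasure_Times_lebesgue)
  have "S2 (indicator D) (x, y) = ennreal (1 / y) * (\<integral>\<^sup>+ s. indicator E s \<partial>lborel)"
    unfolding S2_def nn_integral_completion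
    by (auto simp: E_def intro!: arg_cong2[where f = times] nn_integral_cong split: split_indicator)
  also have "\<dots> = ennreal (1 / (x * y) * x) * emeasure lborel E"
    using xy E by simp
  also have "\<dots> = ennreal (1 / (x * y)) * (ennreal x * emeasure lborel E)"
    using xy by (subst ennreal_mult) (auto simp: ac_simps)
  also have "\<dots> \<le> ennreal (1 / (x * y)) * ennreal (measure lebesgue (corner D x y))"
    by (intro mult_left_mono le) auto
  also have "\<dots> = ennreal (measure lebesgue (corner D x y) / (x * y))"
    using xy by (subst ennreal_mult[symmetric]) auto
  finally show ?thesis .
qed

section \<open>The weighted measure and boundedness without the outer root\<close>

definition weighted :: "(real \<times> real \<Rightarrow> real) \<Rightarrow> (real \<times> real) measure" where
  "weighted u = density (lebesgue_on quadrant) (\<lambda>z. ennreal (u z))"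

lemma sets_weighted: "sets (weighted u) = sets (lebesgue_on quadrant)"
  by (simp add: weighted_def)

lemma nn_integral_weighted:
  assumes "weight u" "g \<in> borel_measurable (lebesgue_on quadrant)"
  shows "(\<integral>\<^sup>+ z. g z \<partial>weighted u) = (\<integral>\<^sup>+ z \<in> quadrant. (g z * ennreal (u z)) \<partial>lebesgue)"
proof -
  have "(\<lambda>z. ennreal (u z)) \<in> borel_measurable (lebesgue_on quadrant)"
    using assms(1) by (auto simp: weight_def)
  then show ?thesis
    using assms(2) unfolding weighted_def
    by (simp add: nn_integral_density nn_integral_restrict_space ac_simps)
qed

lemma ennpowr_antimono_measurable:
  assumes "antimono_on quadrant f"
  shows "(\<lambda>z. ennpowr (f z) p) \<in> borel_measurable (lebesgue_on quadrant)"
  by (rule measurable_compose[OF antimono_on_quadrant_measurable[OF assms] borel_measurable_ennpowr])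

text \<open>The \<open>p\<close>-th power of \<open>Lp_norm\<close>. For \<open>p < 1\<close> the
  norm is not subadditive, and integrals are the natural objects to estimate for every
  \<open>p\<close>.\<close>

definition energy :: "real \<Rightarrow> (real \<times> real \<Rightarrow> real) \<Rightarrow> (real \<times> real \<Rightarrow> ennreal) \<Rightarrow> ennreal" where
  "energy p u f = (\<integral>\<^sup>+ z \<in> quadrant. (ennpowr (f z) p * ennreal (u z)) \<partial>lebesgue)"

lemma energy_weighted:
  assumes "weight u" "antimono_on quadrant f"
  shows "energy p u f = (\<integral>\<^sup>+ z. ennpowr (f z) p \<partial>weighted u)"
  unfolding energy_def nn_integral_weighted[OF assms(1) ennpowr_antimono_measurable[OF assms(2)]] ..

lemma energy_mono:
  assumes "0 < p" "\<And>z. z \<in> quadrant \<Longrightarrow> f z \<le> g z"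
  shows "energy p u f \<le> energy p u g"
  unfolding energy_def using assms(1)
  by (intro nn_integral_mono) (auto split: split_indicator intro!: mult_right_mono ennpowr_mono assms(2))

lemma Lp_dec_energy: "f \<in> Lp_dec p u \<longleftrightarrow> antimono_on quadrant f \<and> energy p u f < top"
  using antimono_on_quadrant_measurable[of f]
  by (auto simp: Lp_dec_def Lp_norm_def decreasing2_iff energy_def)

text \<open>Raising to the power \<open>p\<close> or \<open>1 / p\<close> translates one inequality
  into the other, with the constant changing to \<open>C powr p\<close> or
  \<open>C powr (1 / p)\<close>.\<close>

lemma bounded_Lp_dec_iff:
  assumes p: "0 < p"
  shows "bounded_Lp_dec p u T \<longleftrightarrow> (\<exists>C\<ge>0. \<forall>f. antimono_on quadrant f \<longrightarrow> energy p u f < top \<longrightarrow>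
    energy p u (T f) \<le> ennreal C * energy p u f)"
    (is "?L \<longleftrightarrow> ?R")
proof
  have norm: "Lp_norm p u f = ennpowr (energy p u f) (1 / p)" for f
    by (simp add: Lp_norm_def energy_def)
  {
    assume ?L
    then obtain C where C: "0 \<le> C" "\<And>f. f \<in> Lp_dec p u \<Longrightarrow> Lp_norm p u (T f) \<le> ennreal C * Lp_norm p u f"
      unfolding bounded_Lp_dec_def by auto
    show ?R
    proof (intro exI[of _ "C powr p"] conjI allI impI)
      fix f assume f: "antimono_on quadrant f" "energy p u f < top"
      have "ennpowr (Lp_norm p u (T f)) p \<le> ennpowr (ennreal C * Lp_norm p u f) p"
        using p f by (intro ennpowr_mono C) (auto simp: Lp_dec_energy)
      then show "energy p u (T f) \<le> ennreal (C powr p) * energy p u f"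
        using p C(1) by (simp add: norm ennpowr_mult ennpowr_ennpowr)
    qed simp
  }
  assume ?R
  then obtain C where C: "0 \<le> C" "\<And>f. antimono_on quadrant f \<Longrightarrow> energy p u f < top \<Longrightarrow>
    energy p u (T f) \<le> ennreal C * energy p u f"
    by auto
  show ?L
    unfolding bounded_Lp_dec_def
  proof (intro exI[of _ "C powr (1 / p)"] conjI ballI)
    fix f assume "f \<in> Lp_dec p u"
    then have f: "antimono_on quadrant f" "energy p u f < top"
      by (auto simp: Lp_dec_energy)
    have "ennpowr (energy p u (T f)) (1 / p) \<le> ennpowr (ennreal C * energy p u f) (1 / p)"
      using p f by (intro ennpowr_mono C) auto
    then show "Lp_norm p u (T f) \<le> ennreal (C powr (1 / p)) * Lp_norm p u f"
      using p C(1) by (simp add: norm ennpowr_mult)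
  qed simp
qed

section \<open>Condition (b) and its relation to boundedness\<close>

definition corner_condition :: "real \<Rightarrow> (real \<times> real \<Rightarrow> real) \<Rightarrow> real \<Rightarrow> bool" where
  "corner_condition p u C \<longleftrightarrow> (\<forall>D. decreasing_set D \<longrightarrow>
    (\<integral>\<^sup>+ (x, y) \<in> quadrant - D.
       ennreal (measure lebesgue (corner D x y) powr p / (x * y) powr p * u (x, y)) \<partial>lebesgue)
    \<le> ennreal C * (\<integral>\<^sup>+ z \<in> D. ennreal (u z) \<partial>lebesgue))"

lemma emeasure_weighted:
  assumes "weight u" "decreasing_set D"
  shows "emeasure (weighted u) D = (\<integral>\<^sup>+ z \<in> D. ennreal (u z) \<partial>lebesgue)"
proof -
  have D: "D \<subseteq> quadrant" "D \<in> sets (lebesgue_on quadrant)"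
    using assms(2) decreasing_set_lebesgue[OF assms(2)]
    by (auto simp: decreasing_set_def sets_restrict_space_iff)
  then have "emeasure (weighted u) D = (\<integral>\<^sup>+ z. indicator D z \<partial>weighted u)"
    by (simp add: sets_weighted)
  also have "\<dots> = (\<integral>\<^sup>+ z \<in> quadrant. (indicator D z * ennreal (u z)) \<partial>lebesgue)"
    using D by (intro nn_integral_weighted assms) auto
  also have "\<dots> = (\<integral>\<^sup>+ z \<in> D. ennreal (u z) \<partial>lebesgue)"
    using D(1) by (intro nn_integral_cong) (auto split: split_indicator)
  finally show ?thesis .
qed

lemma corner_integrand:
  assumes "weight u" "0 < x" "0 < y"
  shows "ennreal (measure lebesgue (corner D x y) powr p / (x * y) powr p * u (x, y))
    = ennpowr (ennreal (measure lebesgue (corner D x y) / (x * y))) p * ennreal (u (x, y))"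
  using assms by (simp add: powr_divide weight_def ennreal_mult[symmetric])

lemma ennpowr_indicator: "ennpowr (indicator D z) p = indicator D z"
  by (simp split: split_indicator)

text \<open>The bound for \<open>S\<close> is tested on the indicator of \<open>D\<close>, where
  \<open>S\<close> dominates the normalized corner area; the part of the integral over
  \<open>D\<close> is dropped.\<close>

lemma bounded_S_imp_corner_condition:
  assumes p: "0 < p" and u: "weight u" and S: "bounded_Lp_dec p u S"
  shows "\<exists>C>0. corner_condition p u C"
proof -
  obtain C where C: "0 \<le> C" "\<And>f. antimono_on quadrant f \<Longrightarrow> energy p u f < top \<Longrightarrow>
    energy p u (S f) \<le> ennreal C * energy p u f"
    using S unfolding bounded_Lp_dec_iff[OF p] by auto
  \<comment> \<open>Adding 1 makes the constant strictly positive. This also settles sets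
    \<open>D\<close> of infinite weighted measure, to which boundedness does not apply: the
    right-hand side is then infinite.\<close>
  have "corner_condition p u (C + 1)"
    unfolding corner_condition_def
  proof (intro allI impI)
    fix D assume D: "decreasing_set D"
    let ?I = "\<integral>\<^sup>+ (x, y) \<in> quadrant - D.
       ennreal (measure lebesgue (corner D x y) powr p / (x * y) powr p * u (x, y)) \<partial>lebesgue"
    have D': "D \<in> sets (weighted u)"
      using D decreasing_set_lebesgue[OF D]
      by (auto simp: sets_weighted decreasing_set_def sets_restrict_space_iff)
    note anti = antimono_on_indicator[OF D]
    have "?I \<le> ennreal (C + 1) * emeasure (weighted u) D"
    proof (cases "emeasure (weighted u) D = top")
      case True
      then show ?thesis using C(1) by (simp add: ennreal_mult_top)
    next
      case False
      have "?I \<le> energy p u (S (indicator D))"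
        unfolding energy_def
      proof (rule nn_integral_mono, clarify)
        fix x y :: real
        show "ennreal (measure lebesgue (corner D x y) powr p / (x * y) powr p * u (x, y)) * indicator (quadrant - D) (x, y)
          \<le> ennpowr (S (indicator D) (x, y)) p * ennreal (u (x, y)) * indicator quadrant (x, y)"
        proof (cases "(x, y) \<in> quadrant")
          case True
          then have xy: "0 < x" "0 < y" by auto
          show ?thesis
            unfolding corner_integrand[OF u xy] using p True
            by (auto split: split_indicator intro!: mult_right_mono ennpowr_mono corner_le_S D xy
              simp del: ennpowr_ennreal)
        qed auto
      qed
      also have "\<dots> \<le> ennreal C * emeasure (weighted u) D"
        using C(2)[OF anti] False D' by (simp add: energy_weighted[OF u anti] ennpowr_indicator less_top)
      also have "\<dots> \<le> ennreal (C + 1) * emeasure (weighted u) D"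
        by (intro mult_right_mono ennreal_leI) auto
      finally show ?thesis .
    qed
    then show "?I \<le> ennreal (C + 1) * (\<integral>\<^sup>+ z \<in> D. ennreal (u z) \<partial>lebesgue)"
      by (simp add: emeasure_weighted[OF u D])
  qed
  then show ?thesis using C(1) by (intro exI[of _ "C + 1"]) auto
qed

text \<open>The integral is split along \<open>D\<close>. On \<open>D\<close> the average is at most
  1, contributing the measure of \<open>D\<close>; off \<open>D\<close> it is at most the normalized
  corner area, and condition (b) applies. Hence the constant \<open>C + 1\<close>.\<close>

lemma corner_condition_test:
  fixes T :: "(real \<times> real \<Rightarrow> ennreal) \<Rightarrow> real \<times> real \<Rightarrow> ennreal"
  assumes p: "0 < p" and u: "weight u" and C: "0 < C" "corner_condition p u C"
    and T_anti: "antimono_on quadrant (T (indicator D))"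
    and T_1: "\<And>z. z \<in> quadrant \<Longrightarrow> T (indicator D) z \<le> 1"
    and T_corner: "\<And>x y. 0 < x \<Longrightarrow> 0 < y \<Longrightarrow>
      T (indicator D) (x, y) \<le> ennreal (measure lebesgue (corner D x y) / (x * y))"
    and D: "decreasing_set D"
  shows "(\<integral>\<^sup>+ z. ennpowr (T (indicator D) z) p \<partial>weighted u) \<le> ennreal (C + 1) * emeasure (weighted u) D"
proof -
  let ?I = "\<integral>\<^sup>+ (x, y) \<in> quadrant - D.
       ennreal (measure lebesgue (corner D x y) powr p / (x * y) powr p * u (x, y)) \<partial>lebesgue"
  define G where "G z = ennpowr (T (indicator D) z) p" for z
  have D': "D \<in> sets (lebesgue_on quadrant)"
    using D decreasing_set_lebesgue[OF D]
    by (auto simp: decreasing_set_def sets_restrict_space_iff)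
  have space: "space (weighted u) = quadrant"
    using sets_eq_imp_space_eq[OF sets_weighted] by simp
  have G: "G \<in> borel_measurable (lebesgue_on quadrant)"
    unfolding G_def[abs_def] by (rule ennpowr_antimono_measurable[OF T_anti])
  have G': "(\<lambda>z. G z * indicator (quadrant - D) z) \<in> borel_measurable (lebesgue_on quadrant)"
  proof -
    have "quadrant - D \<in> sets (lebesgue_on quadrant)"
      using sets.compl_sets[OF D'] by simp
    then show ?thesis using G by auto
  qed
  have meas: "g \<in> borel_measurable (weighted u)" if "g \<in> borel_measurable (lebesgue_on quadrant)" for g :: "_ \<Rightarrow> ennreal"
    using that measurable_cong_sets[OF sets_weighted refl] by auto
  have "(\<integral>\<^sup>+ z. G z \<partial>weighted u) \<le> (\<integral>\<^sup>+ z. indicator D z + G z * indicator (quadrant - D) z \<partial>weighted u)"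
  proof (rule nn_integral_mono)
    fix z assume "z \<in> space (weighted u)"
    then have z: "z \<in> quadrant" by (simp add: space)
    then have "G z \<le> 1"
      unfolding G_def using p ennpowr_mono[OF T_1[OF z], of p] by simp
    then show "G z \<le> indicator D z + G z * indicator (quadrant - D) z"
      using z by (auto split: split_indicator)
  qed
  also have "\<dots> = emeasure (weighted u) D + (\<integral>\<^sup>+ z. G z * indicator (quadrant - D) z \<partial>weighted u)"
    using D' by (subst nn_integral_add) (auto simp: sets_weighted intro: meas G')
  also have "(\<integral>\<^sup>+ z. G z * indicator (quadrant - D) z \<partial>weighted u)
      = (\<integral>\<^sup>+ z \<in> quadrant. (G z * indicator (quadrant - D) z * ennreal (u z)) \<partial>lebesgue)"
    by (rule nn_integral_weighted[OF u G'])
  also have "\<dots> \<le> ?I"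
  proof (rule nn_integral_mono, clarify)
    fix x y :: real
    show "G (x, y) * indicator (quadrant - D) (x, y) * ennreal (u (x, y)) * indicator quadrant (x, y)
      \<le> ennreal (measure lebesgue (corner D x y) powr p / (x * y) powr p * u (x, y)) * indicator (quadrant - D) (x, y)"
    proof (cases "(x, y) \<in> quadrant")
      case True
      then have xy: "0 < x" "0 < y" by auto
      show ?thesis
        unfolding corner_integrand[OF u xy] G_def using p True
        by (auto split: split_indicator intro!: mult_right_mono ennpowr_mono T_corner xy
            simp del: ennpowr_ennreal)
    qed auto
  qed
  also have "?I \<le> ennreal C * emeasure (weighted u) D"
    using C(2) D unfolding corner_condition_def emeasure_weighted[OF u D] by blast
  also have "emeasure (weighted u) D + ennreal C * emeasure (weighted u) D = ennreal (C + 1) * emeasure (weighted u) D"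
    using C(1) by (simp add: ennreal_plus distrib_right add.commute)
  finally show ?thesis by (simp add: G_def add_left_mono)
qed

lemma corner_condition_imp_bounded:
  assumes p: "0 < p" and u: "weight u" and C: "0 < C" "corner_condition p u C"
  shows "bounded_Lp_dec p u S1" "bounded_Lp_dec p u S2"
proof -
  interpret S1: tested_average S1 fst "\<lambda>z s. (s, snd z)" "weighted u" p "C + 1"
  proof unfold_locales
    show "(\<integral>\<^sup>+ z. ennpowr (S1 (indicator D) z) p \<partial>weighted u) \<le> ennreal (C + 1) * emeasure (weighted u) D"
      if "decreasing_set D" for D
    proof (rule corner_condition_test[where T = S1 and D = D, OF p u C S1.T_antimono[OF antimono_on_indicator[OF that]] _ _ that])
      show "S1 (indicator D) z \<le> 1" if "z \<in> quadrant" for z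
        using that by (intro S1.T_const_le) (auto split: split_indicator)
    qed (rule S1_indicator_le_corner[OF that])
  qed (use p C sets_weighted in auto)
  interpret S2: tested_average S2 snd "\<lambda>z s. (fst z, s)" "weighted u" p "C + 1"
  proof unfold_locales
    show "(\<integral>\<^sup>+ z. ennpowr (S2 (indicator D) z) p \<partial>weighted u) \<le> ennreal (C + 1) * emeasure (weighted u) D"
      if "decreasing_set D" for D
    proof (rule corner_condition_test[where T = S2 and D = D, OF p u C S2.T_antimono[OF antimono_on_indicator[OF that]] _ _ that])
      show "S2 (indicator D) z \<le> 1" if "z \<in> quadrant" for z
        using that by (intro S2.T_const_le) (auto split: split_indicator)
    qed (rule S2_indicator_le_corner[OF that])
  qed (use p C sets_weighted in auto)
  show "bounded_Lp_dec p u S1"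
    using S1.T_bounded
    by (metis bounded_Lp_dec_iff[OF p] energy_weighted[OF u] S1.T_antimono)
  show "bounded_Lp_dec p u S2"
    using S2.T_bounded
    by (metis bounded_Lp_dec_iff[OF p] energy_weighted[OF u] S2.T_antimono)
qed

text \<open>Averages of decreasing functions dominate them. Thus \<open>f \<le> S2 f\<close> gives
  \<open>S1 f \<le> S f\<close>, and \<open>S2 f \<le> S1 (S2 f)\<close> gives
  \<open>S2 f \<le> S f\<close>. Conversely, \<open>S\<close> is a composition of operators that
  preserve the cone.\<close>

lemma bounded_S_iff:
  assumes p: "0 < p"
  shows "bounded_Lp_dec p u S \<longleftrightarrow> bounded_Lp_dec p u S1 \<and> bounded_Lp_dec p u S2"
proof (intro iffI conjI)
  note iff = bounded_Lp_dec_iff[OF p]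
  {
    assume "bounded_Lp_dec p u S"
    then obtain C where C: "0 \<le> C" "\<And>f. antimono_on quadrant f \<Longrightarrow> energy p u f < top \<Longrightarrow> energy p u (S f) \<le> ennreal C * energy p u f"
      unfolding iff by auto
    show "bounded_Lp_dec p u S1"
      unfolding iff
    proof (intro exI[of _ C] conjI C allI impI)
      fix f assume f: "antimono_on quadrant f" "energy p u f < top"
      have "energy p u (S1 f) \<le> energy p u (S f)"
        by (intro energy_mono p) (simp add: S_eq_S1_S2[OF f(1)] S1.T_mono S2.le_T[OF f(1)])
      then show "energy p u (S1 f) \<le> ennreal C * energy p u f"
        using C(2)[OF f] by (rule order_trans)
    qed
    show "bounded_Lp_dec p u S2"
      unfolding iff
    proof (intro exI[of _ C] conjI C allI impI)
      fix f assume f: "antimono_on quadrant f" "energy p u f < top"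
      have "energy p u (S2 f) \<le> energy p u (S f)"
        by (intro energy_mono p) (simp add: S_eq_S1_S2[OF f(1)] S1.le_T S2.T_antimono[OF f(1)])
      then show "energy p u (S2 f) \<le> ennreal C * energy p u f"
        using C(2)[OF f] by (rule order_trans)
    qed
  }
  assume "bounded_Lp_dec p u S1 \<and> bounded_Lp_dec p u S2"
  then obtain C1 C2 where C1: "0 \<le> C1" "\<And>f. antimono_on quadrant f \<Longrightarrow> energy p u f < top \<Longrightarrow> energy p u (S1 f) \<le> ennreal C1 * energy p u f"
    and C2: "0 \<le> C2" "\<And>f. antimono_on quadrant f \<Longrightarrow> energy p u f < top \<Longrightarrow> energy p u (S2 f) \<le> ennreal C2 * energy p u f"
    unfolding iff by auto
  show "bounded_Lp_dec p u S"
    unfolding iff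
  proof (intro exI[of _ "C1 * C2"] conjI allI impI)
    fix f assume f: "antimono_on quadrant f" "energy p u f < top"
    \<comment> \<open>The bound for \<open>S1\<close> is about to be applied to \<open>S2 f\<close>,
      which must itself lie in the cone.\<close>
    have "energy p u (S2 f) < top"
      using C2(2)[OF f] f(2) by (auto simp: ennreal_mult_less_top intro: le_less_trans)
    have "energy p u (S f) \<le> energy p u (S1 (S2 f))"
      by (intro energy_mono p) (simp add: S_eq_S1_S2[OF f(1)])
    also have "\<dots> \<le> ennreal C1 * energy p u (S2 f)"
      by (intro C1 S2.T_antimono f) fact
    also have "\<dots> \<le> ennreal C1 * (ennreal C2 * energy p u f)"
      by (intro mult_left_mono C2 f) auto
    finally show "energy p u (S f) \<le> ennreal (C1 * C2) * energy p u f"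
      using C1(1) C2(1) by (simp add: ennreal_mult mult.assoc)
  qed (use C1 C2 in simp)
qed

theorem theorem3p1:
  fixes p :: real and u :: "real \<times> real \<Rightarrow> real"
  assumes "0 < p" and "weight u"
  shows "(bounded_Lp_dec p u S \<longleftrightarrow>
           (\<exists>C::real. C > 0 \<and> (\<forall>D. decreasing_set D \<longrightarrow>
              (\<integral>\<^sup>+ (x, y) \<in> quadrant - D.
                 ennreal (measure lebesgue (corner D x y) powr p / (x * y) powr p * u (x, y)) \<partial>lebesgue)
              \<le> ennreal C * (\<integral>\<^sup>+ z \<in> D. ennreal (u z) \<partial>lebesgue))))
       \<and> (bounded_Lp_dec p u S \<longleftrightarrow> bounded_Lp_dec p u S1 \<and> bounded_Lp_dec p u S2)"
  using bounded_S_iff[OF assms(1)] bounded_S_imp_corner_condition[OF assms]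
    corner_condition_imp_bounded[OF assms]
  unfolding corner_condition_def by blast

end
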